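(* Let $(V,\Delta,V^*,\Delta^\vee)$ be a Kac-Moody root system with Weyl group $W$, let $r$ be the radius of convergence of the Poincaré series $W(t)=\sum_{w\in W}t^{\ell(w)}$, and let $D_r=\{t\in\mathbb{C}:|t|<r\}$. For $t\in D_r$ and $h=x+iy\in V\otimes\mathbb{C}$ with $x\in V$, $y\in W\cdot C$, the sum $$\mathcal{C}(t,h)=\sum_{w\in W}\prod_{a\in\Phi_{re,+}}\frac{1-te^{2\pi i\langle h,wa^\vee\rangle}}{1-e^{2\pi i\langle h,wa^\vee\rangle}}$$ is absolutely convergent, uniformly on compact subsets of $D_r\times(V+iW\cdot C)$, and defines a holomorphic function on the domain $D_r\times(V+iW\cdot C)$.
   Context: A Kac-Moody root system is a quadruple $(V,\Delta,V^*,\Delta^\vee)$ where $V$ is a finite-dimensional real vector space with linear dual $V^*$, $\Delta\subset V$ is a finite linearly independent subset (the simple roots), and $\Delta^\vee\subset V^*$ is a finite linearly independent subset with a bijection $\Delta\to\Delta^\vee$, $a\mapsto a^\vee$, such that, with $\langle-,-\rangle$ the natural pairing between $V$ and $V^*$: $\langle a,a^\vee\rangle=2$ for $a\in\Delta$; $\langle a,b^\vee\rangle$ is a non-positive integer for $a\neq b$ in $\Delta$; and $\langle a,b^\vee\rangle=0$ implies $\langle b,a^\vee\rangle=0$. For $a\in\Delta$ let $s_a(v)=v-\langle v,a^\vee\rangle a$. The Weyl group $W\subseteq\mathrm{Aut}(V)$ is generated by the $s_a$, $a\in\Delta$, with $\ell$ the length function for these generators; $W$ acts on $V^*$ by $\langle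 v,wl\rangle=\langle w^{-1}v,l\rangle$. A real root is an element of $V$ that is $W$-conjugate to a simple root; $\Phi_{re}$ is the set of real roots and $\Phi_{re,+}$ is the set of real roots that are $\mathbb{Z}_{\geq0}$-linear combinations of simple roots. For a real root $a=wa_0$ with $a_0\in\Delta$, its coroot is $a^\vee=wa_0^\vee$ (well defined). $C=\{x\in V:\langle x,a^\vee\rangle>0\ \forall a\in\Delta\}$ and $W\cdot C=\bigcup_{w\in W}wC$. For $A,B\subseteq V$, $A+iB=\{x+iy\in V\otimes\mathbb{C}:x\in A,\ y\in B\}$. The pairing is extended $\mathbb{C}$-linearly to $V\otimes\mathbb{C}$. An infinite product $\prod_{j}(1-u_j)$ is absolutely convergent if $\sum_j|u_j|<\infty$. *)

theory Defs
  imports "HOL-Analysis.Analysis"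
begin

section \<open>Kac--Moody root systems\<close>

text \<open>
  The space \<open>V\<close> is the type \<open>'a\<close>, whose finite dimension is assumed in the locale (so that
  \<open>dim V = 0\<close> is allowed, unlike for the class \<open>euclidean_space\<close>). The norm only provides
  the canonical topology of \<open>V\<close>. Since every linear functional on a finite-dimensional space is
  bounded, the type \<open>'a \<Rightarrow>\<^sub>L real\<close> is the full linear dual \<open>V\<^sup>*\<close>. The bijection
  \<open>\<Delta> \<rightarrow> \<Delta>\<^sup>\<or>\<close> is the function \<open>cv\<close>.
\<close>

locale kac_moody_root_system =
  fixes \<Delta> :: "'a::real_normed_vector set"
    and \<Delta>v :: "('a \<Rightarrow>\<^sub>L real) set"
    and cv :: "'a \<Rightarrow> ('a \<Rightarrow>\<^sub>L real)"
  assumes finite_dimensional: "\<exists>B. finite B \<and> span B = (UNIV :: 'a set)"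
    and finite_simple_roots: "finite \<Delta>"
    and independent_simple_roots: "independent \<Delta>"
    and finite_simple_coroots: "finite \<Delta>v"
    and independent_simple_coroots: "independent \<Delta>v"
    and bij_coroots: "bij_betw cv \<Delta> \<Delta>v"
    and pairing_diag: "\<And>a. a \<in> \<Delta> \<Longrightarrow> cv a a = 2"
    and pairing_int: "\<And>a b. a \<in> \<Delta> \<Longrightarrow> b \<in> \<Delta> \<Longrightarrow> a \<noteq> b \<Longrightarrow> cv b a \<in> \<int> \<and> cv b a \<le> 0"
    and pairing_zero: "\<And>a b. a \<in> \<Delta> \<Longrightarrow> b \<in> \<Delta> \<Longrightarrow> cv b a = 0 \<Longrightarrow> cv a b = 0"

definition simple_reflection ::
    "('a::real_normed_vector \<Rightarrow> ('a \<Rightarrow>\<^sub>L real)) \<Rightarrow> 'a \<Rightarrow> 'a \<Rightarrow> 'a" where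
  "simple_reflection cv a v = v - cv a v *\<^sub>R a"

inductive_set weyl_group ::
    "'a::real_normed_vector set \<Rightarrow> ('a \<Rightarrow> ('a \<Rightarrow>\<^sub>L real)) \<Rightarrow> ('a \<Rightarrow> 'a) set"
  for \<Delta> :: "'a set" and cv :: "'a \<Rightarrow> ('a \<Rightarrow>\<^sub>L real)" where
  one: "id \<in> weyl_group \<Delta> cv"
| gen: "a \<in> \<Delta> \<Longrightarrow> simple_reflection cv a \<in> weyl_group \<Delta> cv"
| mult: "v \<in> weyl_group \<Delta> cv \<Longrightarrow> w \<in> weyl_group \<Delta> cv \<Longrightarrow> v \<circ> w \<in> weyl_group \<Delta> cv"
| inverse: "w \<in> weyl_group \<Delta> cv \<Longrightarrow> inv w \<in> weyl_group \<Delta> cv"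

text \<open>The generators are involutions, so words in the generators themselves suffice.\<close>

definition weyl_length ::
    "'a::real_normed_vector set \<Rightarrow> ('a \<Rightarrow> ('a \<Rightarrow>\<^sub>L real)) \<Rightarrow> ('a \<Rightarrow> 'a) \<Rightarrow> nat" where
  "weyl_length \<Delta> cv w =
     (LEAST n. \<exists>as. length as = n \<and> set as \<subseteq> \<Delta> \<and>
        w = foldr (\<lambda>a g. simple_reflection cv a \<circ> g) as id)"

definition dual_action ::
    "('a::real_normed_vector \<Rightarrow> 'a) \<Rightarrow> ('a \<Rightarrow>\<^sub>L real) \<Rightarrow> ('a \<Rightarrow>\<^sub>L real)" where
  "dual_action w l = Blinfun (\<lambda>v. l (inv w v))"

definition real_roots ::
    "'a::real_normed_vector set \<Rightarrow> ('a \<Rightarrow> ('a \<Rightarrow>\<^sub>L real)) \<Rightarrow> 'a set" where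
  "real_roots \<Delta> cv = {w a | w a. w \<in> weyl_group \<Delta> cv \<and> a \<in> \<Delta>}"

definition pos_real_roots ::
    "'a::real_normed_vector set \<Rightarrow> ('a \<Rightarrow> ('a \<Rightarrow>\<^sub>L real)) \<Rightarrow> 'a set" where
  "pos_real_roots \<Delta> cv =
     {v \<in> real_roots \<Delta> cv. \<exists>n :: 'a \<Rightarrow> nat. v = (\<Sum>a\<in>\<Delta>. real (n a) *\<^sub>R a)}"

definition coroot ::
    "'a::real_normed_vector set \<Rightarrow> ('a \<Rightarrow> ('a \<Rightarrow>\<^sub>L real)) \<Rightarrow> 'a \<Rightarrow> ('a \<Rightarrow>\<^sub>L real)" where
  "coroot \<Delta> cv a =
     (THE l. \<exists>w\<in>weyl_group \<Delta> cv. \<exists>a0\<in>\<Delta>. a = w a0 \<and> l = dual_action w (cv a0))"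

definition open_chamber ::
    "'a::real_normed_vector set \<Rightarrow> ('a \<Rightarrow> ('a \<Rightarrow>\<^sub>L real)) \<Rightarrow> 'a set" where
  "open_chamber \<Delta> cv = {x. \<forall>a\<in>\<Delta>. cv a x > 0}"

definition weyl_chambers ::
    "'a::real_normed_vector set \<Rightarrow> ('a \<Rightarrow> ('a \<Rightarrow>\<^sub>L real)) \<Rightarrow> 'a set" where
  "weyl_chambers \<Delta> cv = (\<Union>w\<in>weyl_group \<Delta> cv. w ` open_chamber \<Delta> cv)"

definition poincare_series ::
    "'a::real_normed_vector set \<Rightarrow> ('a \<Rightarrow> ('a \<Rightarrow>\<^sub>L real)) \<Rightarrow> complex fps" where
  "poincare_series \<Delta> cv =
     Abs_fps (\<lambda>n. of_nat (card {w \<in> weyl_group \<Delta> cv. weyl_length \<Delta> cv w = n}))"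

section \<open>The complexification and holomorphy\<close>

text \<open>
  The complexification of \<open>V\<close> is \<open>'a \<times> 'a\<close>, where \<open>(x, y)\<close> stands for \<open>x + i y\<close>.
\<close>

definition complexified_scale ::
    "complex \<Rightarrow> 'a::real_vector \<times> 'a \<Rightarrow> 'a \<times> 'a" where
  "complexified_scale c h =
     (Re c *\<^sub>R fst h - Im c *\<^sub>R snd h, Im c *\<^sub>R fst h + Re c *\<^sub>R snd h)"

definition complexified_pairing ::
    "'a::real_normed_vector \<times> 'a \<Rightarrow> ('a \<Rightarrow>\<^sub>L real) \<Rightarrow> complex" where
  "complexified_pairing h l = of_real (l (fst h)) + \<i> * of_real (l (snd h))"

text \<open>
  Holomorphy on an open subset of the complex vector space \<open>\<complex> \<times> (V \<otimes> \<complex>)\<close>: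
  the Frechet derivative exists at every point and is complex-linear.
\<close>

definition holomorphic_on_complexified ::
    "(complex \<times> ('a::real_normed_vector \<times> 'a) \<Rightarrow> complex) \<Rightarrow>
     (complex \<times> ('a \<times> 'a)) set \<Rightarrow> bool" where
  "holomorphic_on_complexified f S \<longleftrightarrow>
     open S \<and>
     (\<forall>p\<in>S. \<exists>D. (f has_derivative D) (at p) \<and>
        (\<forall>c s h. D (c * s, complexified_scale c h) = c * D (s, h)))"

section \<open>Infinite products over a set\<close>

definition abs_convergent_product_on :: "('b \<Rightarrow> complex) \<Rightarrow> 'b set \<Rightarrow> bool" where
  "abs_convergent_product_on f A \<longleftrightarrow> (\<lambda>j. norm (1 - f j)) summable_on A"

text \<open>Unordered product, the multiplicative analogue of \<open>infsum\<close>.\<close>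

definition infinite_product :: "('b \<Rightarrow> complex) \<Rightarrow> 'b set \<Rightarrow> complex" where
  "infinite_product f A = Lim (finite_subsets_at_top A) (prod f)"

section \<open>The sum over the Weyl group\<close>

definition c_factor ::
    "'a::real_normed_vector set \<Rightarrow> ('a \<Rightarrow> ('a \<Rightarrow>\<^sub>L real)) \<Rightarrow>
     complex \<Rightarrow> 'a \<times> 'a \<Rightarrow> ('a \<Rightarrow> 'a) \<Rightarrow> 'a \<Rightarrow> complex" where
  "c_factor \<Delta> cv t h w a =
     (let e = exp (2 * of_real pi * \<i> * complexified_pairing h (dual_action w (coroot \<Delta> cv a)))
      in (1 - t * e) / (1 - e))"

definition c_term ::
    "'a::real_normed_vector set \<Rightarrow> ('a \<Rightarrow> ('a \<Rightarrow>\<^sub>L real)) \<Rightarrow>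
     complex \<Rightarrow> 'a \<times> 'a \<Rightarrow> ('a \<Rightarrow> 'a) \<Rightarrow> complex" where
  "c_term \<Delta> cv t h w = infinite_product (c_factor \<Delta> cv t h w) (pos_real_roots \<Delta> cv)"

definition c_sum ::
    "'a::real_normed_vector set \<Rightarrow> ('a \<Rightarrow> ('a \<Rightarrow>\<^sub>L real)) \<Rightarrow>
     complex \<Rightarrow> 'a \<times> 'a \<Rightarrow> complex" where
  "c_sum \<Delta> cv t h = (\<Sum>\<^sub>\<infinity>w\<in>weyl_group \<Delta> cv. c_term \<Delta> cv t h w)"

definition c_domain ::
    "'a::real_normed_vector set \<Rightarrow> ('a \<Rightarrow> ('a \<Rightarrow>\<^sub>L real)) \<Rightarrow>
     (complex \<times> ('a \<times> 'a)) set" where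
  "c_domain \<Delta> cv =
     eball 0 (fps_conv_radius (poincare_series \<Delta> cv)) \<times> (UNIV \<times> weyl_chambers \<Delta> cv)"

end

theory Submission
  imports Defs "HOL-Complex_Analysis.Complex_Analysis"
begin

text \<open>
  Let \<open>y\<close> lie in the chamber \<open>uC\<close>. In the factors of the term of \<open>w\<close> the exponent pairs \<open>y\<close> with
  \<open>wa\<^sup>\<or>\<close>, that is, \<open>u\<inverse>y \<in> C\<close> with \<open>u\<inverse>wa\<^sup>\<or>\<close>, which is a nonnegative or a nonpositive integral
  combination of simple coroots. In the first case the exponential \<open>e\<close> is small and the factor is
  close to \<open>1\<close>; in the second case, which occurs for exactly \<open>\<ell>(u\<inverse>w)\<close> positive roots \<open>a\<close>, the
  inverse of \<open>e\<close> is small and the factor is close to \<open>t\<close>. As distinct \<open>a\<close> give distinct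
  combinations, the errors are controlled by a geometric series over \<open>\<nat>\<^sup>\<Delta>\<close>, uniformly in \<open>w\<close>. So for
  \<open>\<bar>t\<bar> \<le> \<rho> < r\<close> the term of \<open>w\<close> is at most a constant times \<open>\<rho>\<close> to the power \<open>\<ell>(u\<inverse>w)\<close>, locally
  uniformly in \<open>h\<close>, and the Poincare series at \<open>\<rho>\<close> is a majorant. Holomorphy follows since Cauchy's
  estimate on complex lines makes derivatives of a uniformly convergent sequence converge.

  The algebraic input is that \<open>wa\<close> and \<open>wa\<^sup>\<or>\<close> have the same sign, decided by comparing the lengths
  of \<open>w\<close> and \<open>ws\<^sub>a\<close>. It is proved by splitting off the longest possible suffix of \<open>w\<close> alternating
  between two generators, which reduces it to a computation in rank two.
\<close>

section \<open>Words in reflections and rank two\<close>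

definition reflection :: "'v::real_vector \<Rightarrow> ('v \<Rightarrow> real) \<Rightarrow> 'v \<Rightarrow> 'v" where
  "reflection a f v = v - f v *\<^sub>R a"

text \<open>The vectors and functionals are arbitrary families, so that one computation serves
  simple roots paired with coroots and, with the roles exchanged, simple coroots paired with
  roots.\<close>

definition word_act :: "('i \<Rightarrow> 'v::real_vector) \<Rightarrow> ('i \<Rightarrow> 'v \<Rightarrow> real) \<Rightarrow> 'i list \<Rightarrow> 'v \<Rightarrow> 'v" where
  "word_act \<alpha> \<phi> xs = foldr (\<lambda>i g. reflection (\<alpha> i) (\<phi> i) \<circ> g) xs id"

lemma word_act_simps [simp]:
  "word_act \<alpha> \<phi> [] = id"
  "word_act \<alpha> \<phi> (i # xs) = reflection (\<alpha> i) (\<phi> i) \<circ> word_act \<alpha> \<phi> xs"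
  by (simp_all add: word_act_def)

lemma word_act_append [simp]: "word_act \<alpha> \<phi> (xs @ ys) = word_act \<alpha> \<phi> xs \<circ> word_act \<alpha> \<phi> ys"
  by (induction xs) (auto simp: o_assoc)

lemma linear_reflection: "linear f \<Longrightarrow> linear (reflection a f)"
  by (rule linearI) (auto simp: reflection_def linear_add linear_scale algebra_simps)

text \<open>Words are built from the right: a nonempty alternating word ends with \<open>j\<close>.\<close>

fun alternating :: "'i \<Rightarrow> 'i \<Rightarrow> nat \<Rightarrow> 'i list" where
  "alternating i j 0 = []"
| "alternating i j (Suc k) = (if even k then j else i) # alternating i j k"

lemma alternating_numeral:
  "alternating i j (numeral n) =
     (if even (pred_numeral n) then j else i) # alternating i j (pred_numeral n)"
  by (simp add: numeral_eq_Suc)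

lemma alternating_snoc: "alternating i j (Suc k) = alternating j i k @ [j]"
  by (induction k) auto

lemma length_alternating [simp]: "length (alternating i j k) = k"
  by (induction k) auto

lemma set_alternating: "set (alternating i j k) \<subseteq> {i, j}"
  by (induction k) auto

lemma alternating_suffix:
  "m \<le> k \<Longrightarrow> \<exists>pre. alternating i j k = pre @ alternating i j m \<and> length pre = k - m"
proof (induction k)
  case (Suc k)
  show ?case
  proof (cases "m = Suc k")
    case False
    with Suc obtain pre where "alternating i j k = pre @ alternating i j m"
      "length pre = k - m" by auto
    with False Suc.prems show ?thesis
      by (intro exI[of _ "(if even k then j else i) # pre"]) auto
  qed auto
qed auto

text \<open>
  Coordinates of the image of the first simple root under \<open>alternating i j k\<close>, in terms of
  \<open>p = - \<langle>\<alpha>\<^sub>j, \<alpha>\<^sub>i\<^sup>\<or>\<rangle>\<close> and \<open>q = - \<langle>\<alpha>\<^sub>i, \<alpha>\<^sub>j\<^sup>\<or>\<rangle>\<close>.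
\<close>

fun rank2_coords :: "nat \<Rightarrow> nat \<Rightarrow> nat \<Rightarrow> int \<times> int" where
  "rank2_coords p q 0 = (1, 0)"
| "rank2_coords p q (Suc k) = (let (x, y) = rank2_coords p q k in
     if even k then (x, int q * x - y) else (int p * y - x, y))"

text \<open>The invariant says that the coordinate about to be replaced is at most half of what its
  mirror image is computed from: \<open>Q * x \<ge> 2 * y\<close> before \<open>y\<close> becomes
  \<open>y' = Q * x - y\<close>. Then \<open>2 * y' \<ge> Q * x\<close>, and multiplying by
  \<open>P\<close> and using \<open>P * Q \<ge> 4\<close> gives \<open>P * y' \<ge> 2 * x\<close>,
  which is the invariant for the next step.\<close>

lemma rank2_coords_infinite:
  assumes "p * q \<ge> 4"
  shows "fst (rank2_coords p q k) \<ge> 0 \<and> snd (rank2_coords p q k) \<ge> 0"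
proof -
  define P Q where "P = int p" and "Q = int q"
  have pq: "P * Q \<ge> 4" "P \<ge> 0" "Q \<ge> 0"
    using assms by (auto simp: P_def Q_def simp flip: of_nat_mult)
  have "fst (rank2_coords p q k) \<ge> 0 \<and> snd (rank2_coords p q k) \<ge> 0 \<and>
    (if even k then Q * fst (rank2_coords p q k) \<ge> 2 * snd (rank2_coords p q k)
     else P * snd (rank2_coords p q k) \<ge> 2 * fst (rank2_coords p q k))"
  proof (induction k)
    case 0
    show ?case using pq by simp
  next
    case (Suc k)
    obtain x y where xy: "rank2_coords p q k = (x, y)" by fastforce
    have step: "P' * y' \<ge> 2 * x' \<and> y' \<ge> 0"
      if "x' \<ge> 0" "y0 \<ge> 0" "Q' * x' \<ge> 2 * y0" "P' * Q' \<ge> 4" "P' \<ge> 0" "y' = Q' * x' - y0"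
      for x' y0 y' P' Q' :: int
    proof -
      have "2 * y' \<ge> Q' * x'" using that by simp
      then have "P' * (Q' * x') \<le> P' * (2 * y')" using that by (intro mult_left_mono)
      moreover have "4 * x' \<le> (P' * Q') * x'" using that by (intro mult_right_mono)
      ultimately have "4 * x' \<le> 2 * (P' * y')" by (simp add: mult.assoc mult.left_commute)
      with \<open>2 * y' \<ge> Q' * x'\<close> that show ?thesis by simp
    qed
    show ?case
    proof (cases "even k")
      case True
      with step[of x y Q P "Q * x - y"] Suc pq xy show ?thesis
        by (auto simp: P_def Q_def)
    next
      case False
      with step[of y x P Q "P * y - x"] Suc pq xy show ?thesis
        by (auto simp: P_def Q_def mult.commute)
    qed
  qed
  then show ?thesis by simp
qed

text \<open>These are the rank two finite types A1 x A1, A2, B2 and G2, the last two in both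
  orientations.\<close>

lemma small_cartan_product:
  fixes p q :: nat
  assumes "p = 0 \<longleftrightarrow> q = 0" "p * q < 4"
  obtains "p = 0" "q = 0" | "p = 1" "q = 1" | "p = 1" "q = 2" | "p = 2" "q = 1"
    | "p = 1" "q = 3" | "p = 3" "q = 1"
proof -
  have "p < 4" "q < 4"
  proof -
    have "p \<le> p * q" "q \<le> p * q" using assms by auto
    then show "p < 4" "q < 4" using assms(2) by linarith+
  qed
  then have "p \<in> {0,1,2,3}" "q \<in> {0,1,2,3}" by auto
  then show thesis using assms that by auto
qed

text \<open>For \<open>p * q < 4\<close> this is the order of the product of the two simple
  reflections, that is, the length of the braid relation; larger products give a value without this
  meaning.\<close>

definition rank2_order :: "nat \<Rightarrow> nat \<Rightarrow> nat" where
  "rank2_order p q = (if p * q = 0 then 2 else if p * q = 1 then 3 else if p * q = 2 then 4 else 6)"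

text \<open>In a finite dihedral group the first simple root stays positive under alternating words
  shorter than the braid relation. Only finitely many pairs \<open>(p, q)\<close> and lengths
  \<open>k\<close> remain, and each is evaluated.\<close>

lemma rank2_coords_finite:
  assumes "p = 0 \<longleftrightarrow> q = 0" "p * q < 4" "k < rank2_order p q"
  shows "fst (rank2_coords p q k) \<ge> 0 \<and> snd (rank2_coords p q k) \<ge> 0"
proof -
  have "k < 6" using assms(3) by (auto simp: rank2_order_def split: if_splits)
  then have k: "k \<in> {0,1,2,3,4,5}" by auto
  show ?thesis
    using assms(1,2) by (cases rule: small_cartan_product)
      (use k assms(3) in \<open>auto simp: rank2_order_def eval_nat_numeral\<close>)
qed

text \<open>Both reflections preserve the set of vectors \<open>comb X Y\<close> and change one of
  the two coefficients by an affine rule. Both words can therefore be evaluated symbolically on an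
  arbitrary \<open>v = comb 0 0\<close>, for each finite type, without assuming that the two vectors
  are independent.\<close>

lemma braid_relation:
  assumes "linear (\<phi> i)" "linear (\<phi> j)" "\<phi> i (\<alpha> i) = 2" "\<phi> j (\<alpha> j) = 2"
    and "\<phi> i (\<alpha> j) = - real p" "\<phi> j (\<alpha> i) = - real q"
    and "p = 0 \<longleftrightarrow> q = 0" "p * q < 4"
  shows "word_act \<alpha> \<phi> (alternating i j (rank2_order p q)) =
         word_act \<alpha> \<phi> (alternating j i (rank2_order p q))"
proof
  fix v
  define comb where "comb X Y = v - X *\<^sub>R \<alpha> i - Y *\<^sub>R \<alpha> j" for X Y :: real
  have step: "reflection (\<alpha> i) (\<phi> i) (comb X Y) = comb (\<phi> i v - X + p * Y) Y"
    "reflection (\<alpha> j) (\<phi> j) (comb X Y) = comb X (\<phi> j v - Y + q * X)" for X Y :: real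
    using assms
    by (simp_all add: comb_def reflection_def linear_diff linear_add linear_scale algebra_simps
        flip: scaleR_2)
  have v: "v = comb 0 0" by (simp add: comb_def)
  show "word_act \<alpha> \<phi> (alternating i j (rank2_order p q)) v =
        word_act \<alpha> \<phi> (alternating j i (rank2_order p q)) v"
    using assms(7,8)
    by (cases rule: small_cartan_product; subst (1 2) v)
      (simp_all add: rank2_order_def alternating_numeral step ac_simps)
qed

lemma word_act_alternating:
  assumes "linear (\<phi> i)" "linear (\<phi> j)" "\<phi> i (\<alpha> i) = 2" "\<phi> j (\<alpha> j) = 2"
    and "\<phi> i (\<alpha> j) = - real p" "\<phi> j (\<alpha> i) = - real q"
  shows "word_act \<alpha> \<phi> (alternating i j k) (\<alpha> i) =
     of_int (fst (rank2_coords p q k)) *\<^sub>R \<alpha> i + of_int (snd (rank2_coords p q k)) *\<^sub>R \<alpha> j"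
proof (induction k)
  case (Suc k)
  obtain x y where xy: "rank2_coords p q k = (x, y)" by fastforce
  have "\<phi> j (of_int x *\<^sub>R \<alpha> i + of_int y *\<^sub>R \<alpha> j) = 2 * of_int y - q * of_int x"
    "\<phi> i (of_int x *\<^sub>R \<alpha> i + of_int y *\<^sub>R \<alpha> j) = 2 * of_int x - p * of_int y"
    using assms by (simp_all add: linear_add linear_scale)
  moreover have "(2 * r) *\<^sub>R \<alpha> l = r *\<^sub>R \<alpha> l + r *\<^sub>R \<alpha> l" for r l
    by (metis mult_2 scaleR_add_left)
  ultimately show ?case using Suc xy
    by (auto simp: reflection_def scaleR_left_diff_distrib)
qed auto

section \<open>Signs of roots and coroots\<close>

text \<open>The assumptions are symmetric under exchanging roots with coroots. Indexing both
  families by the same set makes this exchange another instance of the locale (\<open>dual\<close>),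
  so each statement about roots yields its analogue for coroots.\<close>

locale cartan_pairing =
  fixes I :: "'i set" and \<alpha> :: "'i \<Rightarrow> 'v::real_vector" and \<alpha>v :: "'i \<Rightarrow> 'l::real_vector"
    and B :: "'v \<Rightarrow> 'l \<Rightarrow> real"
  assumes finite_index: "finite I"
    and linear_left: "linear (\<lambda>v. B v l)"
    and linear_right: "linear (B v)"
    and roots_independent: "\<And>f i. (\<Sum>i\<in>I. f i *\<^sub>R \<alpha> i) = 0 \<Longrightarrow> i \<in> I \<Longrightarrow> f i = (0::real)"
    and coroots_independent: "\<And>f i. (\<Sum>i\<in>I. f i *\<^sub>R \<alpha>v i) = 0 \<Longrightarrow> i \<in> I \<Longrightarrow> f i = (0::real)"
    and pairing_self: "i \<in> I \<Longrightarrow> B (\<alpha> i) (\<alpha>v i) = 2"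
    and pairing_nonpos: "i \<in> I \<Longrightarrow> j \<in> I \<Longrightarrow> i \<noteq> j \<Longrightarrow> \<exists>n. B (\<alpha> i) (\<alpha>v j) = - real n"
    and pairing_zero_sym: "i \<in> I \<Longrightarrow> j \<in> I \<Longrightarrow> B (\<alpha> i) (\<alpha>v j) = 0 \<Longrightarrow> B (\<alpha> j) (\<alpha>v i) = 0"
begin

section \<open>Words acting on roots and coroots, and their length\<close>

definition act :: "'i list \<Rightarrow> 'v \<Rightarrow> 'v" where
  "act = word_act \<alpha> (\<lambda>i v. B v (\<alpha>v i))"

definition coact :: "'i list \<Rightarrow> 'l \<Rightarrow> 'l" where
  "coact = word_act \<alpha>v (\<lambda>i l. B (\<alpha> i) l)"

definition pos :: "'v \<Rightarrow> bool" where
  "pos v \<longleftrightarrow> (\<exists>n :: 'i \<Rightarrow> nat. v = (\<Sum>i\<in>I. real (n i) *\<^sub>R \<alpha> i))"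

definition copos :: "'l \<Rightarrow> bool" where
  "copos l \<longleftrightarrow> (\<exists>n :: 'i \<Rightarrow> nat. l = (\<Sum>i\<in>I. real (n i) *\<^sub>R \<alpha>v i))"

text \<open>Nondegeneracy of the pairing is not among the assumptions, so agreement on both sides is
  required; this also keeps the length unchanged under duality.\<close>

definition eqv :: "'i list \<Rightarrow> 'i list \<Rightarrow> bool" where
  "eqv xs ys \<longleftrightarrow> act xs = act ys \<and> coact xs = coact ys"

definition len :: "'i list \<Rightarrow> nat" where
  "len xs = (LEAST n. \<exists>ys. length ys = n \<and> set ys \<subseteq> I \<and> eqv xs ys)"

lemma dual: "cartan_pairing I \<alpha>v \<alpha> (\<lambda>l v. B v l)"
  by (rule cartan_pairing.intro)
    (fact finite_index linear_left linear_right roots_independent coroots_independent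
      pairing_self | metis pairing_nonpos pairing_zero_sym)+

lemma dual_simps:
  "cartan_pairing.act \<alpha>v \<alpha> (\<lambda>l v. B v l) = coact"
  "cartan_pairing.coact \<alpha>v \<alpha> (\<lambda>l v. B v l) = act"
  "cartan_pairing.pos I \<alpha>v = copos"
  "cartan_pairing.copos I \<alpha> = pos"
  by (simp_all add: fun_eq_iff act_def coact_def pos_def copos_def cartan_pairing.act_def[OF dual]
      cartan_pairing.coact_def[OF dual] cartan_pairing.pos_def[OF dual]
      cartan_pairing.copos_def[OF dual])

lemma act_Nil [simp]: "act [] = id" and act_append [simp]: "act (xs @ ys) = act xs \<circ> act ys"
  by (simp_all add: act_def)

lemma act_Cons: "act (i # xs) v = act xs v - B (act xs v) (\<alpha>v i) *\<^sub>R \<alpha> i"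
  by (simp add: act_def reflection_def)

lemma linear_act: "linear (act xs)"
  unfolding act_def
  by (induction xs)
    (simp_all add: id_def linear_ident linear_compose[unfolded o_def] linear_reflection linear_left)

lemma coact_Nil [simp]: "coact [] = id"
  and coact_append [simp]: "coact (xs @ ys) = coact xs \<circ> coact ys"
  and coact_Cons: "coact (i # xs) l = coact xs l - B (\<alpha> i) (coact xs l) *\<^sub>R \<alpha>v i"
  and linear_coact: "linear (coact xs)"
  using cartan_pairing.act_Nil[OF dual] cartan_pairing.act_append[OF dual]
    cartan_pairing.act_Cons[OF dual] cartan_pairing.linear_act[OF dual]
  by (simp_all add: dual_simps)

lemma act_single: "act [i] v = v - B v (\<alpha>v i) *\<^sub>R \<alpha> i"
  and coact_single: "coact [i] l = l - B (\<alpha> i) l *\<^sub>R \<alpha>v i"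
  by (simp_all add: act_Cons coact_Cons)

lemma act_simple: "i \<in> I \<Longrightarrow> act [i] (\<alpha> i) = - \<alpha> i"
  and coact_simple: "i \<in> I \<Longrightarrow> coact [i] (\<alpha>v i) = - \<alpha>v i"
  by (simp_all add: act_single coact_single pairing_self scaleR_2)

lemma pairing_act: "set xs \<subseteq> I \<Longrightarrow> B (act xs v) (coact xs l) = B v l"
proof (induction xs)
  case (Cons i xs)
  then show ?case
    by (simp add: act_Cons coact_Cons linear_diff[OF linear_left] linear_diff[OF linear_right]
        linear_scale[OF linear_left] linear_scale[OF linear_right] pairing_self)
qed auto

lemma act_cancel: "set xs \<subseteq> I \<Longrightarrow> act (rev xs) (act xs v) = v"
proof (induction xs)
  case (Cons i xs)
  then show ?case
    by (simp add: act_single act_Cons linear_diff[OF linear_left] linear_scale[OF linear_left]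
        pairing_self algebra_simps)
qed auto

lemma coact_cancel: "set xs \<subseteq> I \<Longrightarrow> coact (rev xs) (coact xs l) = l"
  using cartan_pairing.act_cancel[OF dual] by (simp add: dual_simps)

lemma act_cancel': "set xs \<subseteq> I \<Longrightarrow> act xs (act (rev xs) v) = v"
  and coact_cancel': "set xs \<subseteq> I \<Longrightarrow> coact xs (coact (rev xs) l) = l"
  using act_cancel[of "rev xs"] coact_cancel[of "rev xs"] by simp_all

lemma pairing_act_left: "set xs \<subseteq> I \<Longrightarrow> B v (coact xs l) = B (act (rev xs) v) l"
  by (metis act_cancel' pairing_act)

lemma eqv_refl [simp]: "eqv xs xs"
  and eqv_sym: "eqv xs ys \<Longrightarrow> eqv ys xs"
  and eqv_trans [trans]: "eqv xs ys \<Longrightarrow> eqv ys zs \<Longrightarrow> eqv xs zs"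
  and eqv_append: "eqv xs ys \<Longrightarrow> eqv us vs \<Longrightarrow> eqv (xs @ us) (ys @ vs)"
  by (simp_all add: eqv_def)

lemma eqv_double: "i \<in> I \<Longrightarrow> eqv [i, i] []"
  using act_cancel[of "[i]"] coact_cancel[of "[i]"] by (auto simp: eqv_def fun_eq_iff act_def coact_def)

lemma eqv_insert_double: "i \<in> I \<Longrightarrow> eqv (xs @ ys) (xs @ [i, i] @ ys)"
  using eqv_append[OF eqv_refl eqv_append[OF eqv_sym[OF eqv_double] eqv_refl], of i xs ys] by simp

lemma len_le: "set ys \<subseteq> I \<Longrightarrow> eqv xs ys \<Longrightarrow> len xs \<le> length ys"
  unfolding len_def by (rule Least_le) auto

lemma len_witness:
  assumes "set xs \<subseteq> I"
  obtains ys where "length ys = len xs" "set ys \<subseteq> I" "eqv xs ys"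
proof -
  have "\<exists>ys. length ys = len xs \<and> set ys \<subseteq> I \<and> eqv xs ys"
    unfolding len_def by (rule LeastI_ex) (use assms in \<open>auto intro!: exI[of _ xs]\<close>)
  with that show thesis by blast
qed

lemma len_cong: "eqv xs ys \<Longrightarrow> len xs = len ys"
  unfolding len_def eqv_def by simp

lemma len_append_le:
  assumes "set xs \<subseteq> I" "set ys \<subseteq> I"
  shows "len (xs @ ys) \<le> len xs + length ys"
proof -
  obtain zs where "length zs = len xs" "set zs \<subseteq> I" "eqv xs zs"
    using len_witness[OF assms(1)] by blast
  with len_le[of "zs @ ys" "xs @ ys"] assms eqv_append[OF _ eqv_refl] show ?thesis by auto
qed

lemma len_snoc_ge:
  assumes "set xs \<subseteq> I" "i \<in> I"
  shows "len xs \<le> Suc (len (xs @ [i]))"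
  using len_append_le[of "xs @ [i]" "[i]"] len_cong[OF eqv_insert_double[of i xs "[]"]] assms
  by simp

lemma pos_simple: "i \<in> I \<Longrightarrow> pos (\<alpha> i)"
  unfolding pos_def using finite_index
  by (intro exI[of _ "\<lambda>j. if j = i then 1 else 0"])
    (simp add: if_distrib[of real] if_distrib[of "\<lambda>x. x *\<^sub>R _"] cong: if_cong)

lemma pos_combination:
  assumes "pos u" "pos v" "x \<ge> 0" "y \<ge> 0"
  shows "pos (of_int x *\<^sub>R u + of_int y *\<^sub>R v)"
proof -
  obtain m n :: "'i \<Rightarrow> nat" where "u = (\<Sum>i\<in>I. real (m i) *\<^sub>R \<alpha> i)" "v = (\<Sum>i\<in>I. real (n i) *\<^sub>R \<alpha> i)"
    using assms unfolding pos_def by blast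
  then show ?thesis
    unfolding pos_def using assms(3,4)
    by (intro exI[of _ "\<lambda>i. nat x * m i + nat y * n i"])
      (simp add: scaleR_sum_right sum.distrib[symmetric] scaleR_add_left)
qed

lemma copos_simple: "i \<in> I \<Longrightarrow> copos (\<alpha>v i)"
  and copos_combination: "copos u \<Longrightarrow> copos v \<Longrightarrow> x \<ge> 0 \<Longrightarrow> y \<ge> 0 \<Longrightarrow>
      copos (of_int x *\<^sub>R u + of_int y *\<^sub>R v)"
  using cartan_pairing.pos_simple[OF dual] cartan_pairing.pos_combination[OF dual]
  by (simp_all add: dual_simps)

section \<open>The sign of a root and its coroot in terms of lengths\<close>

text \<open>If the two reflections generate an infinite group, or \<open>k\<close> lies below the
  order \<open>m\<close> of their product, the coordinates are nonnegative. Otherwise the suffix of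
  length \<open>k\<close> is long enough to apply the braid relation of length
  \<open>m\<close>.\<close>

lemma rank2:
  assumes "i \<in> I" "j \<in> I" "i \<noteq> j"
  obtains (coords) x y x' y' where "x \<ge> 0" "y \<ge> 0" "x' \<ge> 0" "y' \<ge> 0"
      "act (alternating i j k) (\<alpha> i) = of_int x *\<^sub>R \<alpha> i + of_int y *\<^sub>R \<alpha> j"
      "coact (alternating i j k) (\<alpha>v i) = of_int x' *\<^sub>R \<alpha>v i + of_int y' *\<^sub>R \<alpha>v j"
    | (braid) m where "0 < m" "m \<le> k" "eqv (alternating i j m) (alternating j i m)"
proof -
  obtain p q where pq: "B (\<alpha> j) (\<alpha>v i) = - real p" "B (\<alpha> i) (\<alpha>v j) = - real q"
    using pairing_nonpos assms by metis
  have pq0: "p = 0 \<longleftrightarrow> q = 0"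
    using pairing_zero_sym[of i j] pairing_zero_sym[of j i] assms pq by auto
  have act: "act (alternating i j k) (\<alpha> i) =
      of_int (fst (rank2_coords p q k)) *\<^sub>R \<alpha> i + of_int (snd (rank2_coords p q k)) *\<^sub>R \<alpha> j"
    unfolding act_def using pq pairing_self assms
    by (intro word_act_alternating linear_left) auto
  \<comment> \<open>On coroots the Cartan matrix is transposed, so \<open>p\<close> and
    \<open>q\<close> change places.\<close>
  have coact: "coact (alternating i j k) (\<alpha>v i) =
      of_int (fst (rank2_coords q p k)) *\<^sub>R \<alpha>v i + of_int (snd (rank2_coords q p k)) *\<^sub>R \<alpha>v j"
    unfolding coact_def using pq pairing_self assms
    by (intro word_act_alternating linear_right) auto
  show thesis
  proof (cases "p * q \<ge> 4")
    case True
    with rank2_coords_infinite[of p q k] rank2_coords_infinite[of q p k] coords[OF _ _ _ _ act coact]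
    show thesis by (simp add: mult.commute)
  next
    case False
    define m where "m = rank2_order p q"
    have m: "m > 0" "rank2_order q p = m" by (simp_all add: m_def rank2_order_def mult.commute)
    show thesis
    proof (cases "k < m")
      case True
      with False rank2_coords_finite[of p q k] rank2_coords_finite[of q p k]
        coords[OF _ _ _ _ act coact] m pq0
      show thesis by (auto simp: mult.commute m_def)
    next
      case k: False
      have "act (alternating i j m) = act (alternating j i m)"
        unfolding act_def m_def using pq pairing_self assms pq0 False
        by (intro braid_relation linear_left) auto
      moreover have "coact (alternating i j m) = coact (alternating j i m)"
        unfolding coact_def m(2)[symmetric] using pq pairing_self assms pq0 False
        by (intro braid_relation linear_right) (auto simp: mult.commute)
      ultimately show thesis using braid[of m] m k by (simp add: eqv_def)
    qed
  qed
qed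

text \<open>Induction on the length. Root and coroot are treated together because the factorization
  of \<open>xs\<close> into a shorter word and an alternating suffix is the same for both.\<close>

theorem ascent_positive:
  "set xs \<subseteq> I \<Longrightarrow> i \<in> I \<Longrightarrow> len xs \<le> len (xs @ [i]) \<Longrightarrow>
     pos (act xs (\<alpha> i)) \<and> copos (coact xs (\<alpha>v i))"
proof (induction "len xs" arbitrary: xs i rule: less_induct)
  case (less xs i)
  obtain ys where ys: "length ys = len xs" "set ys \<subseteq> I" "eqv xs ys"
    using len_witness less.prems by blast
  show ?case
  proof (cases ys rule: rev_exhaust)
    case Nil
    with ys less.prems show ?thesis by (simp add: eqv_def pos_simple copos_simple)
  next
    case (snoc ws j)
    have j: "j \<in> I" and ws: "set ws \<subseteq> I" using snoc ys by auto
    \<comment> \<open>If a shortest word for \<open>xs\<close> ended with \<open>i\<close>,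
      appending \<open>i\<close> would cancel that letter and shorten it, against the assumed
      ascent.\<close>
    have "i \<noteq> j"
    proof
      assume "i = j"
      then have "eqv (xs @ [i]) (ws @ [i, i] @ [])"
        using eqv_append[OF ys(3) eqv_refl, of "[i]"] snoc by simp
      also have "eqv \<dots> (ws @ [])"
        by (intro eqv_sym[OF eqv_insert_double] less.prems)
      finally have "len (xs @ [i]) \<le> length ws" using len_le[OF ws] by simp
      then show False using less.prems(3) ys(1) snoc by simp
    qed
    \<comment> \<open>An alternating suffix of length \<open>k\<close> can be split off with lengths
      adding up. The last letter of the shortest word \<open>ys\<close> gives such a suffix for
      \<open>k = 1\<close>.\<close>
    define P where "P k \<longleftrightarrow> (\<exists>zs. set zs \<subseteq> I \<and> eqv xs (zs @ alternating i j k) \<and> len zs + k = len xs)" for k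
    have alt: "set (alternating i j k) \<subseteq> I" for k
      using set_alternating[of i j k] less.prems j by auto
    have "P 1"
      unfolding P_def
    proof (intro exI[of _ ws] conjI)
      show "eqv xs (ws @ alternating i j 1)" using ys snoc by simp
      have "len xs \<le> len ws + 1"
        using len_append_le[OF ws, of "[j]"] j len_cong[OF ys(3)] snoc by simp
      moreover have "len ws \<le> length ws" using len_le[OF ws] by simp
      ultimately show "len ws + 1 = len xs" using ys snoc by simp
    qed (use ws in auto)
    define k where "k = (GREATEST k. P k)"
    have bound: "P k \<Longrightarrow> k \<le> len xs" for k by (auto simp: P_def)
    have k: "P k" "1 \<le> k" and greatest: "\<not> P (Suc k)"
    proof -
      show "P k" unfolding k_def by (rule GreatestI_nat[of P 1 "len xs"]) (use \<open>P 1\<close> bound in auto)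
      show "1 \<le> k" unfolding k_def by (rule Greatest_le_nat[of P 1 "len xs"]) (use \<open>P 1\<close> bound in auto)
      have "P (Suc k) \<Longrightarrow> Suc k \<le> k"
        unfolding k_def by (rule Greatest_le_nat[of P _ "len xs"]) (auto dest: bound)
      then show "\<not> P (Suc k)" by auto
    qed
    then obtain zs where zs: "set zs \<subseteq> I" "eqv xs (zs @ alternating i j k)" "len zs + k = len xs"
      unfolding P_def by blast
    obtain k' where k': "k = Suc k'" using k by (cases k) auto
    \<comment> \<open>Here \<open>c\<close> is the letter that would prolong the alternating suffix
      on its left, and \<open>d\<close> is the first letter of the suffix.\<close>
    define c d where "c = (if even k then j else i)" and "d = (if even k then i else j)"
    have cd: "c \<in> I" "d \<in> I" "{c, d} = {i, j}" using less.prems j by (auto simp: c_def d_def)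
    have "len zs \<le> len (zs @ [c])"
    \<comment> \<open>A descent of \<open>zs\<close> at \<open>c\<close> would let \<open>c\<close>
      move from the end of \<open>zs\<close> into the suffix, contradicting the maximality of
      \<open>k\<close>.\<close>
    proof (rule ccontr)
      assume "\<not> ?thesis"
      then have "len (zs @ [c]) + Suc k = len xs" using len_snoc_ge[OF zs(1) cd(1)] zs by simp
      moreover have "eqv xs ((zs @ [c]) @ alternating i j (Suc k))"
        using eqv_trans[OF zs(2) eqv_insert_double[OF cd(1)]] by (simp flip: c_def)
      ultimately have "P (Suc k)"
        unfolding P_def using zs(1) cd(1) by (intro exI[of _ "zs @ [c]"]) simp
      with greatest show False ..
    qed
    moreover have "len zs \<le> len (zs @ [d])"
    \<comment> \<open>A descent of \<open>zs\<close> at \<open>d\<close> would allow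
      \<open>d\<close> to be absorbed into \<open>zs\<close>, making \<open>xs\<close> shorter than
      its length.\<close>
    proof -
      have "alternating i j k = d # alternating i j k'" by (simp add: k' d_def)
      then have "len xs \<le> len (zs @ [d]) + k'"
        using zs(1) cd len_append_le[of "zs @ [d]" "alternating i j k'"] len_cong[OF zs(2)] alt by simp
      then show ?thesis using zs k' by simp
    qed
    moreover have "len zs < len xs" using zs k by simp
    ultimately have "pos (act zs (\<alpha> c)) \<and> copos (coact zs (\<alpha>v c))"
      "pos (act zs (\<alpha> d)) \<and> copos (coact zs (\<alpha>v d))"
      using less.hyps[OF _ zs(1)] cd(1,2) by simp_all
    then have IH: "pos (act zs (\<alpha> i))" "copos (coact zs (\<alpha>v i))"
      "pos (act zs (\<alpha> j))" "copos (coact zs (\<alpha>v j))"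
      using cd(3) by (auto simp: doubleton_eq_iff)
    from less.prems(2) j \<open>i \<noteq> j\<close> show ?thesis
    proof (cases rule: rank2[where k = k])
      case (coords x y x' y')
      with zs show ?thesis
        by (simp add: eqv_def linear_add[OF linear_act] linear_scale[OF linear_act]
            linear_add[OF linear_coact] linear_scale[OF linear_coact]
            pos_combination copos_combination IH)
    next
      case (braid m)
      obtain pre where pre: "alternating i j k = pre @ alternating i j m" "length pre = k - m"
        using alternating_suffix[OF braid(2), of i j] by auto
      obtain m' where m': "m = Suc m'" using braid by (cases m) auto
      have pre_I: "set pre \<subseteq> I" using alt[of k] pre(1) by simp
      \<comment> \<open>The last \<open>m\<close> letters of the suffix can be rewritten by the
        braid relation so that they end with \<open>i\<close>. The appended \<open>i\<close> then
        cancels, and \<open>xs @ [i]\<close> is shorter than \<open>xs\<close>, against the assumed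
        ascent.\<close>
      have "eqv (xs @ [i]) ((zs @ pre) @ (alternating i j m' @ [i, i] @ []))"
      proof -
        have "eqv (xs @ [i]) (((zs @ pre) @ alternating i j m) @ [i])"
          using eqv_append[OF zs(2) eqv_refl, of "[i]"] pre by simp
        also have "eqv \<dots> (((zs @ pre) @ alternating j i m) @ [i])"
          by (intro eqv_append eqv_refl braid)
        also have "\<dots> = (zs @ pre) @ (alternating i j m' @ [i, i] @ [])"
          by (simp only: m' alternating_snoc) simp
        finally show ?thesis .
      qed
      also have "eqv \<dots> ((zs @ pre) @ (alternating i j m' @ []))"
        by (intro eqv_append eqv_refl eqv_sym[OF eqv_insert_double] less.prems)
      finally have "len (xs @ [i]) = len (zs @ pre @ alternating i j m')"
        by (simp add: len_cong)
      then have "len (xs @ [i]) \<le> len zs + length (pre @ alternating i j m')"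
        using len_append_le[of zs "pre @ alternating i j m'"] zs(1) pre_I alt by simp
      then show ?thesis using zs pre m' braid less.prems by simp
    qed
  qed
qed

lemma descent_negative:
  assumes "set xs \<subseteq> I" "i \<in> I" "len (xs @ [i]) < len xs"
  shows "pos (- act xs (\<alpha> i)) \<and> copos (- coact xs (\<alpha>v i))"
proof -
  have "len ((xs @ [i]) @ [i]) = len xs"
    using len_cong[OF eqv_insert_double[of i xs "[]"]] assms by simp
  then have "pos (act (xs @ [i]) (\<alpha> i)) \<and> copos (coact (xs @ [i]) (\<alpha>v i))"
    using assms by (intro ascent_positive) auto
  then show ?thesis
    using assms by (simp add: act_simple coact_simple linear_neg[OF linear_act] linear_neg[OF linear_coact])
qed

lemma signs_agree:
  assumes "set xs \<subseteq> I" "i \<in> I"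
  shows "pos (act xs (\<alpha> i)) \<and> copos (coact xs (\<alpha>v i)) \<or>
         pos (- act xs (\<alpha> i)) \<and> copos (- coact xs (\<alpha>v i))"
  using ascent_positive[OF assms] descent_negative[OF assms] by linarith


section \<open>Real roots determine their coroots\<close>

lemma coeff_eq_0:
  assumes "(\<Sum>i\<in>I. f i *\<^sub>R \<alpha> i) + (\<Sum>i\<in>I. g i *\<^sub>R \<alpha> i) = c *\<^sub>R \<alpha> j" "i \<in> I" "j \<in> I"
  shows "f i + g i = (if i = j then c else 0)"
proof -
  have "(\<Sum>i\<in>I. (if i = j then c else 0) *\<^sub>R \<alpha> i) = (\<Sum>i\<in>I. if i = j then c *\<^sub>R \<alpha> i else 0)"
    by (intro sum.cong) auto
  also have "\<dots> = c *\<^sub>R \<alpha> j" using assms finite_index by simp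
  finally have "(\<Sum>i\<in>I. (f i + g i - (if i = j then c else 0)) *\<^sub>R \<alpha> i) = 0"
    using assms(1) by (simp add: scaleR_add_left scaleR_left_diff_distrib sum.distrib sum_subtractf)
  from roots_independent[OF this assms(2)] show ?thesis by simp
qed

lemma simple_nonzero: "i \<in> I \<Longrightarrow> \<alpha> i \<noteq> 0"
  using pairing_self[of i] linear_0[OF linear_left] by fastforce

lemma act_simple_nonzero: "set xs \<subseteq> I \<Longrightarrow> i \<in> I \<Longrightarrow> act xs (\<alpha> i) \<noteq> 0"
  by (metis act_cancel linear_0 linear_act simple_nonzero)

lemma pos_antisym:
  assumes "pos v" "pos (- v)"
  shows "v = 0"
proof (cases "I = {}")
  case False
  then obtain j where j: "j \<in> I" by blast
  obtain m n :: "'i \<Rightarrow> nat" where mn: "v = (\<Sum>i\<in>I. real (m i) *\<^sub>R \<alpha> i)" "- v = (\<Sum>i\<in>I. real (n i) *\<^sub>R \<alpha> i)"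
    using assms unfolding pos_def by blast
  then have "(\<Sum>i\<in>I. real (m i) *\<^sub>R \<alpha> i) + (\<Sum>i\<in>I. real (n i) *\<^sub>R \<alpha> i) = 0 *\<^sub>R \<alpha> j"
    by (metis add.right_inverse scaleR_zero_left)
  from coeff_eq_0[OF this _ j] have "\<forall>i\<in>I. m i = 0" by (metis add_is_0 of_nat_add of_nat_eq_0_iff)
  with mn show ?thesis by simp
qed (use assms[unfolded pos_def] in auto)

text \<open>A simple reflection changes only one coordinate.\<close>

lemma pos_reflect_neg:
  assumes "pos v" "pos (- (v - c *\<^sub>R \<alpha> j))" "j \<in> I"
  obtains n :: nat where "v = real n *\<^sub>R \<alpha> j"
proof -
  obtain m n :: "'i \<Rightarrow> nat" where mn: "v = (\<Sum>i\<in>I. real (m i) *\<^sub>R \<alpha> i)"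
    "- (v - c *\<^sub>R \<alpha> j) = (\<Sum>i\<in>I. real (n i) *\<^sub>R \<alpha> i)"
    using assms unfolding pos_def by blast
  then have "(\<Sum>i\<in>I. real (m i) *\<^sub>R \<alpha> i) + (\<Sum>i\<in>I. real (n i) *\<^sub>R \<alpha> i) = c *\<^sub>R \<alpha> j"
    by (metis add.commute diff_add_cancel minus_diff_eq)
  from coeff_eq_0[OF this _ assms(3)] have "m i = 0" if "i \<in> I" "i \<noteq> j" for i
    using that by (metis add_is_0 of_nat_add of_nat_eq_0_iff)
  then have "v = (\<Sum>i\<in>I. if i = j then real (m i) *\<^sub>R \<alpha> i else 0)"
    unfolding mn(1) by (intro sum.cong) auto
  with that[of "m j"] finite_index assms(3) show thesis by simp
qed

text \<open>The image of \<open>\<alpha>v i\<close> has the sign of \<open>\<alpha> j\<close>, and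
  reflecting it in \<open>j\<close> reverses this sign. A reflection affects only one coordinate, so
  the image is a multiple of \<open>\<alpha>v j\<close>; invariance of the pairing forces the
  multiple to be 1.\<close>

lemma coroot_of_simple:
  assumes "set xs \<subseteq> I" "i \<in> I" "j \<in> I" "act xs (\<alpha> i) = \<alpha> j"
  shows "coact xs (\<alpha>v i) = \<alpha>v j"
proof -
  have np: "\<not> pos (- \<alpha> j)" using pos_antisym pos_simple simple_nonzero assms(3) by blast
  have "copos (coact xs (\<alpha>v i))"
    using signs_agree[OF assms(1,2)] np assms(4) by auto
  moreover have "copos (- (coact xs (\<alpha>v i) - B (\<alpha> j) (coact xs (\<alpha>v i)) *\<^sub>R \<alpha>v j))"
  proof -
    have "act (j # xs) (\<alpha> i) = - \<alpha> j"
      using assms by (simp add: act_Cons pairing_self scaleR_2)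
    with signs_agree[of "j # xs" i] assms np show ?thesis by (auto simp: coact_Cons)
  qed
  ultimately obtain n :: nat where n: "coact xs (\<alpha>v i) = real n *\<^sub>R \<alpha>v j"
    using cartan_pairing.pos_reflect_neg[OF dual] assms(3) unfolding dual_simps by metis
  have "B (\<alpha> j) (coact xs (\<alpha>v i)) = 2"
    using pairing_act[OF assms(1), of "\<alpha> i" "\<alpha>v i"] assms pairing_self by simp
  with n assms pairing_self have "n = 1" by (simp add: linear_scale[OF linear_right])
  with n show ?thesis by simp
qed

text \<open>Moving back by \<open>rev ys\<close> reduces the claim to the case of a simple root.
  This is what makes the coroot of a real root well defined; the dual statement
  \<open>root_unique\<close> makes distinct real roots have distinct coroots.\<close>

lemma coroot_unique:
  assumes "set xs \<subseteq> I" "set ys \<subseteq> I" "i \<in> I" "j \<in> I" "act xs (\<alpha> i) = act ys (\<alpha> j)"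
  shows "coact xs (\<alpha>v i) = coact ys (\<alpha>v j)"
proof -
  have "coact (rev ys @ xs) (\<alpha>v i) = \<alpha>v j"
    using assms by (intro coroot_of_simple) (auto simp: act_cancel)
  then show ?thesis using coact_cancel'[OF assms(2)] by (metis coact_append comp_apply)
qed

lemma root_unique:
  assumes "set xs \<subseteq> I" "set ys \<subseteq> I" "i \<in> I" "j \<in> I" "coact xs (\<alpha>v i) = coact ys (\<alpha>v j)"
  shows "act xs (\<alpha> i) = act ys (\<alpha> j)"
  using cartan_pairing.coroot_unique[OF dual, unfolded dual_simps, OF assms] .

section \<open>Inversion sets and their cardinality\<close>

definition posroots :: "'v set" where
  "posroots = {act xs (\<alpha> i) | xs i. set xs \<subseteq> I \<and> i \<in> I \<and> pos (act xs (\<alpha> i))}"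

lemma posrootE:
  assumes "v \<in> posroots"
  obtains ys j where "set ys \<subseteq> I" "j \<in> I" "v = act ys (\<alpha> j)"
  using assms that unfolding posroots_def by blast

definition inversions :: "'i list \<Rightarrow> 'v set" where
  "inversions xs = {v \<in> posroots. pos (- act xs v)}"

lemma simple_posroot: "i \<in> I \<Longrightarrow> \<alpha> i \<in> posroots"
  unfolding posroots_def using pos_simple by (force intro!: exI[of _ "[]"])

lemma posroots_nonneg: "v \<in> posroots \<Longrightarrow> pos v" and posroots_nonzero: "v \<in> posroots \<Longrightarrow> v \<noteq> 0"
  using act_simple_nonzero by (auto simp: posroots_def)

lemma posroot_act_sign: "v \<in> posroots \<Longrightarrow> set xs \<subseteq> I \<Longrightarrow> pos (act xs v) \<or> pos (- act xs v)"
  using signs_agree[of "xs @ _"] by (fastforce simp: posroots_def)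

text \<open>Moving back to a simple root, \<open>\<alpha> j\<close> becomes \<open>n\<close> times a
  vector whose coordinates are integers. The \<open>j\<close>-th coordinate shows that
  \<open>n\<close> divides 1.\<close>

lemma posroot_multiple:
  assumes "v \<in> posroots" "v = real n *\<^sub>R \<alpha> i" "i \<in> I"
  shows "v = \<alpha> i"
proof -
  obtain ys j where ys: "set ys \<subseteq> I" "j \<in> I" "v = act ys (\<alpha> j)"
    using posrootE[OF assms(1)] .
  have \<alpha>j: "\<alpha> j = real n *\<^sub>R act (rev ys) (\<alpha> i)"
    using act_cancel[OF ys(1), of "\<alpha> j"] ys(3) assms(2) by (metis linear_scale[OF linear_act])
  have *: "n = 1" if "1 *\<^sub>R \<alpha> j = (\<Sum>c\<in>I. (real n * r c) *\<^sub>R \<alpha> c)" "\<bar>r j\<bar> = real k" for r :: "'i \<Rightarrow> real" and k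
  proof -
    have "real n * r j = 1"
      using coeff_eq_0[of "\<lambda>c. real n * r c" "\<lambda>_. 0" 1 j j] that ys(2) by simp
    then have "real n * real k = 1" using that(2) by (metis abs_mult abs_of_nat abs_one)
    then have "real (n * k) = real 1" by simp
    then show "n = 1" unfolding of_nat_eq_iff by simp
  qed
  have "pos (act (rev ys) (\<alpha> i)) \<or> pos (- act (rev ys) (\<alpha> i))"
    using posroot_act_sign[OF simple_posroot[OF assms(3)], of "rev ys"] ys(1) by simp
  then have "n = 1"
  proof (elim disjE)
    assume "pos (act (rev ys) (\<alpha> i))"
    then obtain r :: "'i \<Rightarrow> nat" where "act (rev ys) (\<alpha> i) = (\<Sum>c\<in>I. real (r c) *\<^sub>R \<alpha> c)"
      unfolding pos_def by blast
    with \<alpha>j show "n = 1" by (intro *[of "\<lambda>c. real (r c)"]) (simp_all add: scaleR_sum_right)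
  next
    assume "pos (- act (rev ys) (\<alpha> i))"
    then obtain r :: "'i \<Rightarrow> nat" where "- act (rev ys) (\<alpha> i) = (\<Sum>c\<in>I. real (r c) *\<^sub>R \<alpha> c)"
      unfolding pos_def by blast
    then have "act (rev ys) (\<alpha> i) = (\<Sum>c\<in>I. (- real (r c)) *\<^sub>R \<alpha> c)"
      by (simp add: sum_negf) (metis minus_minus)
    with \<alpha>j show "n = 1"
      by (intro *[of "\<lambda>c. - real (r c)"]) (simp_all add: scaleR_sum_right)
  qed
  with assms show ?thesis by simp
qed

text \<open>If the reflection made \<open>v\<close> negative, \<open>v\<close> would be a multiple
  of \<open>\<alpha> i\<close>, because the other coordinates are unchanged. By
  \<open>posroot_multiple\<close> it would then be \<open>\<alpha> i\<close> itself.\<close>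

lemma simple_permutes_posroots:
  assumes "v \<in> posroots" "i \<in> I" "v \<noteq> \<alpha> i"
  shows "act [i] v \<in> posroots"
proof -
  have "pos (act [i] v)"
  proof (rule ccontr)
    assume "\<not> ?thesis"
    with posroot_act_sign[OF assms(1), of "[i]"] assms(2) have "pos (- act [i] v)" by simp
    with pos_reflect_neg[of v _ i] assms posroots_nonneg obtain n :: nat where "v = real n *\<^sub>R \<alpha> i"
      by (metis act_single)
    with posroot_multiple assms show False by blast
  qed
  moreover obtain ys j where ys: "set ys \<subseteq> I" "j \<in> I" "v = act ys (\<alpha> j)"
    using posrootE[OF assms(1)] .
  moreover have "act [i] v = act (i # ys) (\<alpha> j)"
    using ys act_append[of "[i]" ys] by simp
  ultimately show ?thesis
    unfolding posroots_def using assms(2) by (auto intro!: exI[of _ "i # ys"] exI[of _ j])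
qed

lemma act_act_single: "i \<in> I \<Longrightarrow> act [i] (act [i] v) = v"
  using act_cancel[of "[i]"] by simp

text \<open>The reflection in \<open>i\<close> permutes the positive roots other than
  \<open>\<alpha> i\<close>, so it carries the old inversions to new ones. The root
  \<open>\<alpha> i\<close> itself is added, since \<open>xs\<close> keeps it positive and the
  reflection negates it.\<close>

lemma inversions_snoc:
  assumes "set xs \<subseteq> I" "i \<in> I" "pos (act xs (\<alpha> i))"
  shows "inversions (xs @ [i]) = insert (\<alpha> i) (act [i] ` inversions xs)"
    and "\<alpha> i \<notin> act [i] ` inversions xs" and "inj_on (act [i]) (inversions xs)"
proof -
  have ne: "\<alpha> i \<notin> inversions xs"
    using assms pos_antisym act_simple_nonzero by (auto simp: inversions_def)
  show "inj_on (act [i]) (inversions xs)"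
    using act_act_single[OF assms(2)] by (metis inj_on_inverseI)
  show "\<alpha> i \<notin> act [i] ` inversions xs"
  proof
    assume "\<alpha> i \<in> act [i] ` inversions xs"
    then obtain u where u: "u \<in> posroots" "act [i] u = \<alpha> i" by (auto simp: inversions_def)
    then have "u = - \<alpha> i"
      using act_act_single[OF assms(2), of u] act_simple[OF assms(2)] by simp
    then show False
      using pos_antisym[of u] u pos_simple[OF assms(2)] posroots_nonneg posroots_nonzero by auto
  qed
  show "inversions (xs @ [i]) = insert (\<alpha> i) (act [i] ` inversions xs)"
  proof (intro equalityI subsetI)
    fix v assume v: "v \<in> inversions (xs @ [i])"
    show "v \<in> insert (\<alpha> i) (act [i] ` inversions xs)"
    proof (cases "v = \<alpha> i")
      case False
      with v assms simple_permutes_posroots have "act [i] v \<in> inversions xs"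
        by (auto simp: inversions_def)
      then show ?thesis using act_act_single[OF assms(2), of v] by (metis image_eqI insertCI)
    qed simp
  next
    fix v assume "v \<in> insert (\<alpha> i) (act [i] ` inversions xs)"
    then consider "v = \<alpha> i" | u where "u \<in> inversions xs" "v = act [i] u" by blast
    then show "v \<in> inversions (xs @ [i])"
    proof cases
      case 1
      with assms show ?thesis
        by (simp add: inversions_def simple_posroot act_simple linear_neg[OF linear_act])
    next
      case 2
      with ne have "u \<noteq> \<alpha> i" by auto
      with 2 assms simple_permutes_posroots show ?thesis
        by (auto simp: inversions_def act_act_single)
    qed
  qed
qed

text \<open>Along a shortest word every letter is an ascent, hence adds exactly one inversion by
  \<open>inversions_snoc\<close>.\<close>

lemma card_inversions: "set xs \<subseteq> I \<Longrightarrow> finite (inversions xs) \<and> card (inversions xs) = len xs"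
proof (induction "len xs" arbitrary: xs rule: less_induct)
  case (less xs)
  obtain ys where ys: "length ys = len xs" "set ys \<subseteq> I" "eqv xs ys"
    using len_witness less.prems by blast
  have inv: "inversions xs = inversions ys" using ys by (simp add: inversions_def eqv_def)
  show ?case
  proof (cases ys rule: rev_exhaust)
    case Nil
    then have "inversions ys = {}"
      using pos_antisym posroots_nonneg posroots_nonzero by (auto simp: inversions_def)
    with Nil ys inv show ?thesis by simp
  next
    case (snoc ws j)
    have j: "j \<in> I" and ws: "set ws \<subseteq> I" using snoc ys by auto
    have 1: "len xs \<le> len ws + 1"
      using len_append_le[OF ws, of "[j]"] j len_cong[OF ys(3)] snoc by simp
    have 2: "len ws \<le> length ws" using len_le[OF ws] by simp
    have "len ws = length ws" "len (ws @ [j]) = Suc (len ws)"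
      using 1 2 ys snoc len_cong[OF ys(3)] by simp_all
    with ascent_positive[OF ws j] have "pos (act ws (\<alpha> j))" by simp
    note inversions_snoc[OF ws j this]
    moreover have "finite (inversions ws) \<and> card (inversions ws) = len ws"
      using less.hyps[OF _ ws] \<open>len ws = length ws\<close> ys snoc by simp
    ultimately show ?thesis
      using inv snoc \<open>len ws = length ws\<close> ys by (simp add: card_image)
  qed
qed

section \<open>Coordinates of translated coroots\<close>

text \<open>Since root and coroot have the same sign after applying \<open>xs\<close>, the coroot is
  negative exactly for the inversions. Injectivity of the absolute coordinates allows sums over
  positive roots to be compared with a geometric series over all exponent vectors.\<close>

lemma coroot_coordinates:
  assumes "set xs \<subseteq> I"
    and cor: "\<And>ys j. set ys \<subseteq> I \<Longrightarrow> j \<in> I \<Longrightarrow> cor (act ys (\<alpha> j)) = coact ys (\<alpha>v j)"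
  obtains \<nu> :: "'v \<Rightarrow> 'i \<Rightarrow> nat" where
    "inj_on \<nu> posroots" "\<nu> ` posroots \<subseteq> Pi\<^sub>E I (\<lambda>_. UNIV)"
    "\<And>v. v \<in> posroots \<Longrightarrow> \<exists>i\<in>I. \<nu> v i \<noteq> 0"
    "\<And>v. v \<in> posroots \<Longrightarrow> coact xs (cor v) =
       (if v \<in> inversions xs then -1 else 1) *\<^sub>R (\<Sum>i\<in>I. real (\<nu> v i) *\<^sub>R \<alpha>v i)"
proof -
  define sg where "sg v = (if v \<in> inversions xs then -1 else 1 :: real)" for v
  have sg: "sg v * sg v = 1" "\<bar>sg v\<bar> = 1" for v by (auto simp: sg_def)
  have "copos (sg v *\<^sub>R coact xs (cor v))" if "v \<in> posroots" for v
  proof -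
    obtain ys j where ys: "set ys \<subseteq> I" "j \<in> I" "v = act ys (\<alpha> j)"
      using posrootE[OF \<open>v \<in> posroots\<close>] .
    have "pos (act (xs @ ys) (\<alpha> j)) \<and> copos (coact (xs @ ys) (\<alpha>v j)) \<or>
         pos (- act (xs @ ys) (\<alpha> j)) \<and> copos (- coact (xs @ ys) (\<alpha>v j))"
      using assms(1) ys by (intro signs_agree) auto
    moreover have "act (xs @ ys) (\<alpha> j) \<noteq> 0"
      using assms(1) ys by (intro act_simple_nonzero) auto
    ultimately show ?thesis
      using that ys cor[OF ys(1,2)] pos_antisym[of "act xs v"] by (auto simp: sg_def inversions_def)
  qed
  then have "\<exists>n :: 'i \<Rightarrow> nat. v \<in> posroots \<longrightarrow> sg v *\<^sub>R coact xs (cor v) = (\<Sum>i\<in>I. real (n i) *\<^sub>R \<alpha>v i)" for v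
    unfolding copos_def by blast
  then obtain n :: "'v \<Rightarrow> 'i \<Rightarrow> nat" where n:
    "\<And>v. v \<in> posroots \<Longrightarrow> sg v *\<^sub>R coact xs (cor v) = (\<Sum>i\<in>I. real (n v i) *\<^sub>R \<alpha>v i)"
    by metis
  \<comment> \<open>Restricting to \<open>I\<close> gives a canonical function outside the index
    set, so that the coordinates lie in \<open>Pi\<^sub>E\<close>.\<close>
  define \<nu> where "\<nu> v = restrict (n v) I" for v
  have \<nu>: "coact xs (cor v) = sg v *\<^sub>R (\<Sum>i\<in>I. real (\<nu> v i) *\<^sub>R \<alpha>v i)" if "v \<in> posroots" for v
  proof -
    have "(\<Sum>i\<in>I. real (\<nu> v i) *\<^sub>R \<alpha>v i) = sg v *\<^sub>R coact xs (cor v)"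
      using n[OF that] by (simp add: \<nu>_def cong: sum.cong)
    then show ?thesis using sg(1) by simp
  qed
  have nonzero: "cor v \<noteq> 0" and copos: "copos (cor v)" and coact_nonzero: "coact xs (cor v) \<noteq> 0"
    if "v \<in> posroots" for v
  proof -
    obtain ys j where ys: "set ys \<subseteq> I" "j \<in> I" "v = act ys (\<alpha> j)"
      using posrootE[OF \<open>v \<in> posroots\<close>] .
    then have cv: "cor v = coact ys (\<alpha>v j)" using cor by simp
    then show nz: "cor v \<noteq> 0"
      using cartan_pairing.act_simple_nonzero[OF dual] ys by (simp add: dual_simps)
    then show "coact xs (cor v) \<noteq> 0"
      by (metis assms(1) coact_cancel linear_0 linear_coact)
    show "copos (cor v)"
      using signs_agree[OF ys(1,2)] ys cv that pos_antisym[of v] posroots_nonneg posroots_nonzero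
      by auto
  qed
  show thesis
  proof
    show "\<nu> ` posroots \<subseteq> Pi\<^sub>E I (\<lambda>_. UNIV)" by (auto simp: \<nu>_def)
    show "\<exists>i\<in>I. \<nu> v i \<noteq> 0" if "v \<in> posroots" for v
      using \<nu>[OF that] coact_nonzero[OF that] by (auto intro: ccontr)
    show "coact xs (cor v) = (if v \<in> inversions xs then -1 else 1) *\<^sub>R (\<Sum>i\<in>I. real (\<nu> v i) *\<^sub>R \<alpha>v i)"
      if "v \<in> posroots" for v
      using \<nu>[OF that] by (simp add: sg_def)
    show "inj_on \<nu> posroots"
    proof (rule inj_onI)
      fix v v' assume v: "v \<in> posroots" "v' \<in> posroots" "\<nu> v = \<nu> v'"
      then have "coact xs (cor v) = sg v *\<^sub>R sg v' *\<^sub>R coact xs (cor v')"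
        using \<nu>[of v] \<nu>[of v'] sg(1)[of v'] by simp
      then have "coact xs (cor v) = coact xs ((sg v * sg v') *\<^sub>R cor v')"
        by (simp add: linear_scale[OF linear_coact])
      then have eq: "cor v = (sg v * sg v') *\<^sub>R cor v'"
        using coact_cancel[OF assms(1)] by metis
      \<comment> \<open>Equal absolute coordinates leave the coroots equal up to sign. Opposite
        coroots are excluded because the coroots of positive roots are positive and nonzero.\<close>
      have "sg v * sg v' = 1 \<or> sg v * sg v' = -1" by (auto simp: sg_def)
      then show "v = v'"
      proof
        assume "sg v * sg v' = 1"
        with eq have "cor v = cor v'" by simp
        moreover obtain ys j zs k where "set ys \<subseteq> I" "j \<in> I" "v = act ys (\<alpha> j)"
          "set zs \<subseteq> I" "k \<in> I" "v' = act zs (\<alpha> k)"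
          using posrootE[OF v(1)] posrootE[OF v(2)] by metis
        ultimately show "v = v'" using cor root_unique by metis
      next
        assume "sg v * sg v' = -1"
        with eq have "cor v' = - cor v" by simp
        then have "cor v = 0"
          using copos[OF v(1)] copos[OF v(2)] by (intro cartan_pairing.pos_antisym[OF dual, unfolded dual_simps]) auto
        with nonzero[OF v(1)] show "v = v'" by blast
      qed
    qed
  qed
qed

end

section \<open>Unordered products\<close>

lemma norm_prod_minus_1_le:
  fixes f :: "'b \<Rightarrow> complex"
  assumes "finite F"
  shows "norm (prod f F - 1) \<le> exp (\<Sum>j\<in>F. norm (1 - f j)) - 1"
  using assms
proof induction
  case (insert x F)
  define d S where "d = norm (1 - f x)" and "S = (\<Sum>j\<in>F. norm (1 - f j))"
  have d: "d \<le> exp d - 1" using exp_ge_add_one_self[of d] by linarith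
  have fx: "norm (f x) \<le> exp d"
    using norm_triangle_ineq4[of 1 "1 - f x"] d by (simp add: d_def)
  have "prod f (insert x F) - 1 = f x * (prod f F - 1) - (1 - f x)"
    using insert by (simp add: algebra_simps)
  also have "norm \<dots> \<le> norm (f x) * norm (prod f F - 1) + d"
    unfolding d_def by (metis norm_mult norm_triangle_ineq4)
  also have "\<dots> \<le> exp d * (exp S - 1) + (exp d - 1)"
    using fx insert.IH d by (intro add_mono mult_mono) (auto simp: S_def)
  also have "\<dots> = exp (\<Sum>j\<in>insert x F. norm (1 - f j)) - 1"
    using insert.hyps by (simp add: d_def S_def exp_add algebra_simps)
  finally show ?case .
qed simp

text \<open>The finite products form a Cauchy net with an error independent of \<open>x\<close>. The
  argument avoids logarithms, since factors close to zero or equal to zero are allowed.\<close>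

lemma infinite_product_majorant:
  fixes f :: "'b \<Rightarrow> 'c \<Rightarrow> complex"
  assumes m: "\<And>j x. j \<in> A \<Longrightarrow> x \<in> X \<Longrightarrow> norm (1 - f j x) \<le> m j" "m summable_on A"
    and nonneg: "\<And>j. j \<in> A \<Longrightarrow> 0 \<le> m j"
  shows "uniform_limit X (\<lambda>F x. \<Prod>j\<in>F. f j x) (\<lambda>x. infinite_product (\<lambda>j. f j x) A)
           (finite_subsets_at_top A)"
proof -
  define S where "S = infsum m A"
  define P where "P F x = (\<Prod>j\<in>F. f j x)" for F x
  \<comment> \<open>When \<open>F\<close> grows beyond \<open>F0\<close>, the factor over
    \<open>F0\<close> is at most \<open>exp S\<close> and the rest differs from 1 by at most
    \<open>exp (S - sum m F0) - 1\<close>.\<close>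
  define e where "e F = exp S * (exp (S - sum m F) - 1)" for F
  have sum_le: "sum m F \<le> S" if "finite F" "F \<subseteq> A" for F
    unfolding S_def using that m(2) nonneg by (intro finite_sum_le_infsum) auto
  have e: "dist (P F x) (P F0 x) \<le> e F0" if F: "finite F" "F \<subseteq> A" "F0 \<subseteq> F" and x: "x \<in> X" for F F0 x
  proof -
    have sub: "(\<Sum>j\<in>F'. norm (1 - f j x)) \<le> sum m F'" if "F' \<subseteq> F" for F'
      using that F x m(1) by (intro sum_mono) auto
    have fin: "finite F0" "finite (F - F0)" using F finite_subset by auto
    have "norm (P F0 x) \<le> norm (P F0 x - 1) + 1"
      using norm_triangle_ineq[of "P F0 x - 1" 1] by simp
    also have "\<dots> \<le> exp (\<Sum>j\<in>F0. norm (1 - f j x))"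
      using norm_prod_minus_1_le[OF fin(1), of "\<lambda>j. f j x"] by (simp add: P_def)
    also have "\<dots> \<le> exp S" using sub[OF F(3)] sum_le[of F0] F fin by fastforce
    finally have 1: "norm (P F0 x) \<le> exp S" .
    have "norm (P (F - F0) x - 1) \<le> exp (\<Sum>j\<in>F - F0. norm (1 - f j x)) - 1"
      using norm_prod_minus_1_le[OF fin(2), of "\<lambda>j. f j x"] by (simp add: P_def)
    also have "(\<Sum>j\<in>F - F0. norm (1 - f j x)) \<le> sum m (F - F0)"
      by (rule sub) auto
    also have "sum m (F - F0) = sum m F - sum m F0"
      using F by (intro sum_diff) auto
    also have "\<dots> \<le> S - sum m F0" using sum_le F by auto
    finally have 2: "norm (P (F - F0) x - 1) \<le> exp (S - sum m F0) - 1" by simp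
    have "P F x = P (F - F0) x * P F0 x"
      unfolding P_def using F by (intro prod.subset_diff) auto
    then have "dist (P F x) (P F0 x) = norm (P F0 x) * norm (P (F - F0) x - 1)"
      by (simp add: dist_norm algebra_simps flip: norm_mult)
    also have "\<dots> \<le> e F0"
      unfolding e_def using 1 2 by (intro mult_mono) auto
    finally show ?thesis .
  qed
  have "((\<lambda>F. e F) \<longlongrightarrow> exp S * (exp (S - S) - 1)) (finite_subsets_at_top A)"
    unfolding e_def S_def using infsum_tendsto[OF m(2)] by (intro tendsto_intros)
  then have e0: "(e \<longlongrightarrow> 0) (finite_subsets_at_top A)" by simp
  \<comment> \<open>A sequence of finite sets is extracted in order to obtain the pointwise limit by
    completeness; the error bound \<open>e\<close> then shows that the whole net converges to it
    uniformly.\<close>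
  have "\<exists>F. finite F \<and> F \<subseteq> A \<and> e F < inverse (real (Suc n))" for n
  proof -
    have "\<forall>\<^sub>F F in finite_subsets_at_top A. e F < inverse (real (Suc n))"
      using e0 by (rule order_tendstoD) simp
    then show ?thesis unfolding eventually_finite_subsets_at_top by blast
  qed
  then obtain G where G: "\<And>n. finite (G n)" "\<And>n. G n \<subseteq> A" "\<And>n. e (G n) < inverse (real (Suc n))"
    by metis
  have "\<exists>L. (\<lambda>n. P (G n) x) \<longlonglongrightarrow> L" if x: "x \<in> X" for x
  proof -
    have "Cauchy (\<lambda>n. P (G n) x)"
    proof (rule metric_CauchyI)
      fix \<epsilon> :: real assume "\<epsilon> > 0"
      then obtain N where N: "inverse (real (Suc N)) < \<epsilon> / 2"
        using reals_Archimedean half_gt_zero by blast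
      have "dist (P (G i) x) (P (G j) x) < \<epsilon>" if "i \<ge> N" "j \<ge> N" for i j
      proof -
        have inv: "inverse (real (Suc k)) < \<epsilon> / 2" if "k \<ge> N" for k
          using that N by (smt (verit) inverse_le_imp_le of_nat_0_less_iff of_nat_le_iff le_imp_inverse_le Suc_le_mono zero_less_Suc)
        have "dist (P (G i) x) (P (G j) x) \<le> dist (P (G i \<union> G j) x) (P (G i) x) + dist (P (G i \<union> G j) x) (P (G j) x)"
          by (metis dist_commute dist_triangle)
        also have "\<dots> \<le> e (G i) + e (G j)"
          using G x by (intro add_mono e) auto
        also have "\<dots> < \<epsilon>" using G(3)[of i] G(3)[of j] inv[OF that(1)] inv[OF that(2)] by linarith
        finally show ?thesis .
      qed
      then show "\<exists>M. \<forall>m\<ge>M. \<forall>n\<ge>M. dist (P (G m) x) (P (G n) x) < \<epsilon>" by blast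
    qed
    then show ?thesis by (meson Cauchy_convergent_iff convergent_def)
  qed
  then obtain L where L: "\<And>x. x \<in> X \<Longrightarrow> (\<lambda>n. P (G n) x) \<longlonglongrightarrow> L x" by metis
  have inv0: "(\<lambda>n. inverse (real (Suc n))) \<longlonglongrightarrow> 0" by (rule LIMSEQ_inverse_real_of_nat)
  have near: "dist (P F x) (L x) \<le> e F" if F: "finite F" "F \<subseteq> A" and x: "x \<in> X" for F x
  proof (rule Lim_bounded)
    show "(\<lambda>n. dist (P F x) (P (G n) x) - inverse (real (Suc n))) \<longlonglongrightarrow> dist (P F x) (L x)"
      using tendsto_diff[OF tendsto_dist[OF tendsto_const L[OF x]] inv0] by simp
    show "\<forall>n\<ge>0. dist (P F x) (P (G n) x) - inverse (real (Suc n)) \<le> e F"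
    proof (intro allI impI)
      fix n
      have "dist (P F x) (P (G n) x) \<le> dist (P (F \<union> G n) x) (P F x) + dist (P (F \<union> G n) x) (P (G n) x)"
        by (metis dist_commute dist_triangle)
      also have "\<dots> \<le> e F + e (G n)" using F x G by (intro add_mono e) auto
      finally show "dist (P F x) (P (G n) x) - inverse (real (Suc n)) \<le> e F"
        using G(3)[of n] by linarith
    qed
  qed
  have lim: "uniform_limit X P L (finite_subsets_at_top A)"
  proof (rule uniform_limitI)
    fix \<epsilon> :: real assume "\<epsilon> > 0"
    then have "\<forall>\<^sub>F F in finite_subsets_at_top A. e F < \<epsilon>"
      using e0 by (intro order_tendstoD(2)[of e 0]) auto
    moreover have "\<forall>\<^sub>F F in finite_subsets_at_top A. finite F \<and> F \<subseteq> A"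
      by (rule eventually_finite_subsets_at_top_weakI) auto
    ultimately show "\<forall>\<^sub>F F in finite_subsets_at_top A. \<forall>x\<in>X. dist (P F x) (L x) < \<epsilon>"
      by eventually_elim (use near in fastforce)
  qed
  have "infinite_product (\<lambda>j. f j x) A = L x" if "x \<in> X" for x
    unfolding infinite_product_def
    using tendsto_uniform_limitI[OF lim that]
    by (intro tendsto_Lim) (simp_all add: P_def)
  then show ?thesis
    using lim unfolding P_def by (metis (mono_tags, lifting) uniform_limit_cong')
qed

section \<open>Complex differentiability on a complexification\<close>

definition cscale :: "complex \<Rightarrow> complex \<times> ('a::real_normed_vector \<times> 'a) \<Rightarrow> complex \<times> ('a \<times> 'a)" where
  "cscale c v = (c * fst v, complexified_scale c (snd v))"

definition complex_diff :: "(complex \<times> ('a::real_normed_vector \<times> 'a) \<Rightarrow> complex) \<Rightarrow> complex \<times> ('a \<times> 'a) \<Rightarrow> bool" where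
  "complex_diff f p \<longleftrightarrow> (\<exists>D. (f has_derivative D) (at p) \<and> (\<forall>c v. D (cscale c v) = c * D v))"

lemma holomorphic_on_complexified_iff:
  "holomorphic_on_complexified f S \<longleftrightarrow> open S \<and> (\<forall>p\<in>S. complex_diff f p)"
  by (auto simp: holomorphic_on_complexified_def complex_diff_def cscale_def)

text \<open>The constant counts crude bounds by \<open>norm c * norm v\<close>: one for the first
  coordinate and two for each component of \<open>complexified_scale\<close>.\<close>

lemma norm_cscale_le: "norm (cscale c v) \<le> 5 * norm c * norm v"
proof -
  obtain s x y where v: "v = (s, x, y)" by (metis prod_cases3)
  have n: "norm s \<le> norm v" "norm x \<le> norm v" "norm y \<le> norm v"
    using norm_fst_le[of s "(x, y)"] norm_snd_le[of "(x, y)" s] norm_fst_le[of x y] norm_snd_le[of y x]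
    unfolding v by linarith+
  have part: "norm (a *\<^sub>R x) \<le> norm c * norm v" "norm (a *\<^sub>R y) \<le> norm c * norm v"
    if "\<bar>a\<bar> \<le> norm c" for a
    using that n by (auto intro!: mult_mono)
  have "norm (cscale c v) \<le> norm (c * s) + norm (complexified_scale c (x, y))"
    unfolding v cscale_def by (simp add: norm_Pair_le)
  also have "norm (complexified_scale c (x, y)) \<le>
      norm (Re c *\<^sub>R x - Im c *\<^sub>R y) + norm (Im c *\<^sub>R x + Re c *\<^sub>R y)"
    unfolding complexified_scale_def by (simp add: norm_Pair_le)
  also have "norm (Re c *\<^sub>R x - Im c *\<^sub>R y) \<le> norm c * norm v + norm c * norm v"
    using part abs_Re_le_cmod abs_Im_le_cmod by (intro order.trans[OF norm_triangle_ineq4] add_mono) auto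
  also have "norm (Im c *\<^sub>R x + Re c *\<^sub>R y) \<le> norm c * norm v + norm c * norm v"
    using part abs_Re_le_cmod abs_Im_le_cmod by (intro order.trans[OF norm_triangle_ineq] add_mono) auto
  also have "norm (c * s) \<le> norm c * norm v"
    using n by (simp add: norm_mult mult_left_mono)
  finally show ?thesis by simp
qed

lemma cscale_has_derivative:
  "((\<lambda>z. x + cscale z v) has_derivative (\<lambda>z. cscale z v)) (at z)"
proof -
  have "bounded_linear (\<lambda>z. cscale z v)"
    by (intro bounded_linear_intro[where K = "5 * norm v"])
      (use norm_cscale_le[of _ v] in
        \<open>auto simp: cscale_def complexified_scale_def algebra_simps scaleR_add_left\<close>)
  then show ?thesis
    by (auto intro!: derivative_eq_intros bounded_linear_imp_has_derivative)
qed

lemma cscale_0 [simp]: "cscale 0 v = 0"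
  by (simp add: cscale_def complexified_scale_def prod_eq_iff)

text \<open>Cauchy's estimate on the complex line through \<open>x\<close> in the direction \<open>v\<close>.\<close>

lemma derivative_bound:
  fixes f :: "complex \<times> ('a::real_normed_vector \<times> 'a) \<Rightarrow> complex"
  assumes R: "R > 0" and diff: "\<And>p. p \<in> ball x R \<Longrightarrow> complex_diff f p"
    and bound: "\<And>p. p \<in> ball x R \<Longrightarrow> norm (f p) \<le> M"
    and D: "(f has_derivative D) (at x)"
    and D': "\<And>c v. D (cscale c v) = c * D v"
  shows "norm (D v) \<le> 6 * M / R * norm v"
proof (cases "v = 0")
  case True
  then show ?thesis using D by (simp add: has_derivative_def linear_simps)
next
  case False
  \<comment> \<open>With the factor 5 from \<open>norm_cscale_le\<close>, the 6 keeps the closed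
    disc of radius \<open>r\<close> strictly inside the ball after embedding it in the complex
    line.\<close>
  define r where "r = R / (6 * norm v)"
  define g where "g z = f (x + cscale z v)" for z
  have r: "r > 0" using R False by (simp add: r_def)
  have inball: "x + cscale z v \<in> ball x R" if "norm z \<le> r" for z
  proof -
    have "norm (cscale z v) \<le> 5 * r * norm v"
      using norm_cscale_le[of z v] that by (meson mult_left_mono mult_right_mono norm_ge_zero order.trans zero_le_numeral)
    also have "\<dots> < R" using R False by (simp add: r_def field_simps)
    finally show ?thesis by (simp add: dist_norm)
  qed
  have deriv: "(g has_field_derivative E v) (at z)"
    if "(f has_derivative E) (at (x + cscale z v))" "\<And>c v. E (cscale c v) = c * E v" for z E
  proof -
    have "(g has_derivative (\<lambda>c. E (cscale c v))) (at z)"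
      unfolding g_def by (rule has_derivative_compose[OF cscale_has_derivative that(1)])
    then show ?thesis
      by (simp add: has_field_derivative_def that(2) mult.commute[of _ "E v"])
  qed
  have diffg: "\<exists>d. (g has_field_derivative d) (at z)" if "norm z \<le> r" for z
    using diff[OF inball[OF that]] deriv unfolding complex_diff_def by blast
  have "norm ((deriv ^^ 1) g 0) \<le> fact 1 * M / r ^ 1"
  proof (rule Cauchy_inequality)
    show "g holomorphic_on ball 0 r"
      unfolding holomorphic_on_def field_differentiable_def
    proof
      fix z :: complex assume "z \<in> ball 0 r"
      then show "\<exists>d. (g has_field_derivative d) (at z within ball 0 r)"
        using diffg[of z] has_field_derivative_at_within[of g _ z "ball 0 r"] by auto
    qed
    show "continuous_on (cball 0 r) g"
      using diffg DERIV_isCont[of g] by (intro continuous_at_imp_continuous_on ballI) auto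
    show "norm (g z) \<le> M" if "norm (0 - z) = r" for z
      unfolding g_def using that by (intro bound inball) auto
  qed (use r in auto)
  moreover have "deriv g 0 = D v"
    using deriv[of D 0] D D' by (intro DERIV_imp_deriv) simp
  ultimately show ?thesis using False R by (simp add: r_def field_simps)
qed

section \<open>Uniform limits of complex differentiable functions\<close>

text \<open>Applying \<open>derivative_bound\<close> to the differences \<open>f m - f n\<close>
  makes the derivatives uniformly Cauchy on a smaller ball. The limit function is then
  differentiable there, and complex homogeneity passes to the pointwise limit of the
  derivatives.\<close>

lemma complex_diff_sequence_limit:
  fixes f :: "nat \<Rightarrow> complex \<times> ('a::real_normed_vector \<times> 'a) \<Rightarrow> complex"
  assumes "open S" and diff: "\<And>n p. p \<in> S \<Longrightarrow> complex_diff (f n) p"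
    and lim: "uniform_limit S f g sequentially" and "x \<in> S"
  shows "complex_diff g x"
proof -
  define D where "D n p = (SOME D. (f n has_derivative D) (at p) \<and> (\<forall>c v. D (cscale c v) = c * D v))" for n p
  have D: "(f n has_derivative D n p) (at p)" "D n p (cscale c v) = c * D n p v" if "p \<in> S" for n p c v
    using someI_ex[OF diff[OF that, of n, unfolded complex_diff_def]] unfolding D_def by blast+
  obtain R0 where R0: "R0 > 0" "ball x R0 \<subseteq> S"
    using assms(1,4) openE by blast
  \<comment> \<open>Halving leaves room around each point of \<open>ball x R\<close> for a ball of
    radius \<open>R\<close> inside \<open>S\<close>, on which Cauchy's estimate applies.\<close>
  define R where "R = R0 / 2"
  have R: "R > 0" "\<And>y. y \<in> ball x R \<Longrightarrow> ball y R \<subseteq> S"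
  proof -
    show "R > 0" using R0 by (simp add: R_def)
    fix y assume y: "y \<in> ball x R"
    have "z \<in> ball x R0" if "z \<in> ball y R" for z
      using y that dist_triangle[of x z y] by (simp add: R_def)
    then show "ball y R \<subseteq> S" using R0 by blast
  qed
  have close: "\<exists>N. \<forall>m\<ge>N. \<forall>n\<ge>N. \<forall>y\<in>ball x R. \<forall>v. norm (D m y v - D n y v) \<le> e * norm v"
    if "e > 0" for e
  proof -
    \<comment> \<open>This inverts the constant \<open>6 * M / R\<close> of
      \<open>derivative_bound\<close>.\<close>
    define \<epsilon> where "\<epsilon> = e * R / 6"
    have "\<epsilon> > 0" using R that by (simp add: \<epsilon>_def)
    moreover have "uniformly_Cauchy_on S f"
      using lim by (intro uniformly_convergent_Cauchy) (auto simp: uniformly_convergent_on_def)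
    ultimately obtain N where N: "\<And>m n p. m \<ge> N \<Longrightarrow> n \<ge> N \<Longrightarrow> p \<in> S \<Longrightarrow> dist (f m p) (f n p) < \<epsilon>"
      unfolding uniformly_Cauchy_on_def by metis
    have "norm (D m y v - D n y v) \<le> e * norm v"
      if "m \<ge> N" "n \<ge> N" "y \<in> ball x R" for m n y v
    proof -
      have S: "p \<in> S" if "p \<in> ball y R" for p using R(2)[OF \<open>y \<in> ball x R\<close>] that by blast
      have y: "y \<in> S" using S R(1) by simp
      have "norm ((\<lambda>v. D m y v - D n y v) v) \<le> 6 * \<epsilon> / R * norm v"
      proof (rule derivative_bound[OF R(1), of y "\<lambda>p. f m p - f n p"])
        show "complex_diff (\<lambda>p. f m p - f n p) p" if "p \<in> ball y R" for p
          unfolding complex_diff_def using S[OF that]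
          by (intro exI[of _ "\<lambda>v. D m p v - D n p v"])
            (auto intro!: derivative_eq_intros D simp: D(2) algebra_simps)
        show "norm (f m p - f n p) \<le> \<epsilon>" if "p \<in> ball y R" for p
          using N[OF \<open>m \<ge> N\<close> \<open>n \<ge> N\<close> S[OF that]] by (simp add: dist_norm)
      qed (use y in \<open>auto intro!: derivative_eq_intros D simp: D(2) algebra_simps\<close>)
      then show ?thesis using R(1) by (simp add: \<epsilon>_def)
    qed
    then show ?thesis by blast
  qed
  have "convergent (\<lambda>n. D n y v)" if y: "y \<in> ball x R" for y v
    unfolding Cauchy_convergent_iff[symmetric]
  proof (rule CauchyI')
    fix \<epsilon> :: real assume "\<epsilon> > 0"
    define e where "e = \<epsilon> / (norm v + 1)"
    have e: "e > 0" "e * norm v < \<epsilon>"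
      using \<open>\<epsilon> > 0\<close> by (auto simp: e_def field_simps add_pos_nonneg)
    obtain N where N: "\<forall>m\<ge>N. \<forall>n\<ge>N. \<forall>y\<in>ball x R. \<forall>v. norm (D m y v - D n y v) \<le> e * norm v"
      using close[OF e(1)] by blast
    have "dist (D m y v) (D n y v) < \<epsilon>" if "m \<ge> N" "n > m" for m n
    proof -
      have "n \<ge> N" using that by simp
      with N that(1) y have "norm (D m y v - D n y v) \<le> e * norm v" by blast
      with e(2) show ?thesis by (simp add: dist_norm)
    qed
    then show "\<exists>M. \<forall>m\<ge>M. \<forall>n>m. dist (D m y v) (D n y v) < \<epsilon>" by blast
  qed
  then obtain D' where D': "\<And>y v. y \<in> ball x R \<Longrightarrow> (\<lambda>n. D n y v) \<longlonglongrightarrow> D' y v"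
    unfolding convergent_def by metis
  have "\<exists>h. \<forall>y\<in>ball x R. (\<lambda>n. f n y) \<longlonglongrightarrow> h y \<and> (h has_derivative D' y) (at y within ball x R)"
  proof (rule has_derivative_sequence)
    show "convex (ball x R)" by simp
    show "(f n has_derivative D n y) (at y within ball x R)" if "y \<in> ball x R" for n y
      using D(1)[of y n] R(2)[OF that] R(1) has_derivative_at_withinI by force
    show "x \<in> ball x R" using R by simp
    show "(\<lambda>n. f n x) \<longlonglongrightarrow> g x" using tendsto_uniform_limitI[OF lim \<open>x \<in> S\<close>] .
    show "\<forall>\<^sub>F n in sequentially. \<forall>y\<in>ball x R. \<forall>v. norm (D n y v - D' y v) \<le> e * norm v"
      if "e > 0" for e
    proof -
      obtain N where N: "\<And>m n y v. m \<ge> N \<Longrightarrow> n \<ge> N \<Longrightarrow> y \<in> ball x R \<Longrightarrow>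
          norm (D m y v - D n y v) \<le> e * norm v"
        using close[OF \<open>e > 0\<close>] by blast
      have "norm (D m y v - D' y v) \<le> e * norm v" if "m \<ge> N" "y \<in> ball x R" for m y v
      proof (rule Lim_bounded)
        show "(\<lambda>n. norm (D m y v - D n y v)) \<longlonglongrightarrow> norm (D m y v - D' y v)"
          using D'[OF that(2)] by (intro tendsto_intros)
        show "\<forall>n\<ge>N. norm (D m y v - D n y v) \<le> e * norm v" using N that by blast
      qed
      then show ?thesis unfolding eventually_sequentially by blast
    qed
  qed
  then obtain h where h: "\<And>y. y \<in> ball x R \<Longrightarrow> (\<lambda>n. f n y) \<longlonglongrightarrow> h y"
    "\<And>y. y \<in> ball x R \<Longrightarrow> (h has_derivative D' y) (at y within ball x R)" by blast
  have x: "x \<in> ball x R" using R by simp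
  have "h y = g y" if "y \<in> ball x R" for y
  proof (rule LIMSEQ_unique[OF h(1)[OF that]])
    have "y \<in> S" using R(2)[OF that] R(1) by auto
    then show "(\<lambda>n. f n y) \<longlonglongrightarrow> g y" using tendsto_uniform_limitI[OF lim] by blast
  qed
  moreover have "(h has_derivative D' x) (at x)"
    using h(2)[OF x] at_within_open[OF x] by simp
  ultimately have "(g has_derivative D' x) (at x)"
    by (rule has_derivative_transform_within_open[OF _ _ x, rotated 2]) auto
  moreover have "D' x (cscale c v) = c * D' x v" for c v
  proof (rule LIMSEQ_unique[OF D'[OF x]])
    show "(\<lambda>n. D n x (cscale c v)) \<longlonglongrightarrow> c * D' x v"
      unfolding D(2)[OF \<open>x \<in> S\<close>] by (intro tendsto_intros D'[OF x])
  qed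
  ultimately show ?thesis unfolding complex_diff_def by blast
qed

text \<open>A nontrivial filter contains, for each \<open>n\<close>, an index whose function is
  uniformly within \<open>1 / (n + 1)\<close> of the limit. This reduces limits over finite subsets
  to the case of sequences.\<close>

lemma complex_diff_uniform_limit:
  fixes f :: "'i \<Rightarrow> complex \<times> ('a::real_normed_vector \<times> 'a) \<Rightarrow> complex"
  assumes "open S" and diff: "\<forall>\<^sub>F i in F. \<forall>p\<in>S. complex_diff (f i) p"
    and lim: "uniform_limit S f g F" and "F \<noteq> bot" and "x \<in> S"
  shows "complex_diff g x"
proof -
  have "\<exists>i. (\<forall>p\<in>S. complex_diff (f i) p) \<and> (\<forall>p\<in>S. dist (f i p) (g p) < inverse (real (Suc n)))" for n
    using eventually_happens'[OF \<open>F \<noteq> bot\<close> eventually_conj[OF diff uniform_limitD[OF lim]]] by simp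
  then obtain k where k: "\<And>n p. p \<in> S \<Longrightarrow> complex_diff (f (k n)) p"
    "\<And>n p. p \<in> S \<Longrightarrow> dist (f (k n) p) (g p) < inverse (real (Suc n))"
    by metis
  have "uniform_limit S (\<lambda>n. f (k n)) g sequentially"
  proof (rule uniform_limitI)
    fix e :: real assume "e > 0"
    then have "\<forall>\<^sub>F n in sequentially. inverse (real (Suc n)) < e"
      using LIMSEQ_inverse_real_of_nat by (rule order_tendstoD[rotated])
    then show "\<forall>\<^sub>F n in sequentially. \<forall>p\<in>S. dist (f (k n) p) (g p) < e"
      by eventually_elim (use k(2) in \<open>fastforce intro: less_trans\<close>)
  qed
  then show ?thesis
    by (rule complex_diff_sequence_limit[of S "\<lambda>n. f (k n)", rotated 2])
      (fact assms(1) assms(5) k(1))+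
qed

section \<open>Closure properties of complex differentiability\<close>

lemma complex_diff_const: "complex_diff (\<lambda>_. c) p"
  unfolding complex_diff_def by (intro exI[of _ "\<lambda>_. 0"]) auto

lemma complex_diff_mult:
  assumes "complex_diff f p" "complex_diff g p"
  shows "complex_diff (\<lambda>p. f p * g p) p"
proof -
  obtain D E where D: "(f has_derivative D) (at p)" "\<And>c v. D (cscale c v) = c * D v"
    and E: "(g has_derivative E) (at p)" "\<And>c v. E (cscale c v) = c * E v"
    using assms unfolding complex_diff_def by blast
  show ?thesis unfolding complex_diff_def
    by (intro exI[of _ "\<lambda>v. f p * E v + D v * g p"] conjI has_derivative_mult D E)
      (auto simp: D(2) E(2) algebra_simps)
qed

lemma complex_diff_add:
  assumes "complex_diff f p" "complex_diff g p"
  shows "complex_diff (\<lambda>p. f p + g p) p"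
proof -
  obtain D E where D: "(f has_derivative D) (at p)" "\<And>c v. D (cscale c v) = c * D v"
    and E: "(g has_derivative E) (at p)" "\<And>c v. E (cscale c v) = c * E v"
    using assms unfolding complex_diff_def by blast
  show ?thesis unfolding complex_diff_def
    by (intro exI[of _ "\<lambda>v. D v + E v"] conjI has_derivative_add D E)
      (auto simp: D(2) E(2) algebra_simps)
qed

lemma complex_diff_sum: "(\<And>i. i \<in> A \<Longrightarrow> complex_diff (f i) p) \<Longrightarrow> complex_diff (\<lambda>p. \<Sum>i\<in>A. f i p) p"
  by (induction A rule: infinite_finite_induct) (auto intro: complex_diff_const complex_diff_add)

lemma complex_diff_prod: "(\<And>i. i \<in> A \<Longrightarrow> complex_diff (f i) p) \<Longrightarrow> complex_diff (\<lambda>p. \<Prod>i\<in>A. f i p) p"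
  by (induction A rule: infinite_finite_induct) (auto intro: complex_diff_const complex_diff_mult)

lemma complex_diff_compose:
  assumes "complex_diff f p" "(g has_field_derivative d) (at (f p))"
  shows "complex_diff (\<lambda>p. g (f p)) p"
proof -
  obtain D where D: "(f has_derivative D) (at p)" "\<And>c v. D (cscale c v) = c * D v"
    using assms unfolding complex_diff_def by blast
  have "((\<lambda>p. g (f p)) has_derivative (\<lambda>v. d * D v)) (at p)"
    using assms(2) unfolding has_field_derivative_def by (rule has_derivative_compose[OF D(1)])
  then show ?thesis unfolding complex_diff_def by (auto simp: D(2))
qed

lemma complex_diff_fst: "complex_diff fst p"
  unfolding complex_diff_def by (auto intro!: exI[of _ fst] derivative_eq_intros simp: cscale_def)

lemma complex_diff_pairing: "complex_diff (\<lambda>p. complexified_pairing (snd p) l) p"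
proof -
  have "((\<lambda>p. complexified_pairing (snd p) l) has_derivative (\<lambda>v. complexified_pairing (snd v) l)) (at p)"
    unfolding complexified_pairing_def by (auto intro!: derivative_eq_intros)
  then show ?thesis unfolding complex_diff_def
    by (auto intro!: exI simp: cscale_def complexified_scale_def complexified_pairing_def
        blinfun.diff_right blinfun.add_right blinfun.scaleR_right complex_eq_iff)
qed

lemma complex_diff_exponential_factor:
  fixes p :: "complex \<times> 'a::real_normed_vector \<times> 'a"
  assumes "exp (k * complexified_pairing (snd p) l) \<noteq> 1"
  shows "complex_diff (\<lambda>p. (1 - fst p * exp (k * complexified_pairing (snd p) l)) /
    (1 - exp (k * complexified_pairing (snd p) l))) p"
proof -
  define E where "E p = exp (k * complexified_pairing (snd p) l)" for p :: "complex \<times> 'a \<times> 'a"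
  have E: "complex_diff E p" unfolding E_def
    by (rule complex_diff_compose[OF complex_diff_pairing, of "\<lambda>z. exp (k * z)"])
      (auto intro!: derivative_eq_intros)
  have "complex_diff (\<lambda>p. (1 + (-1) * (fst p * E p)) * inverse (1 - E p)) p"
    using assms
    by (intro complex_diff_mult complex_diff_add complex_diff_const complex_diff_fst E
        complex_diff_compose[OF E, of "\<lambda>z. inverse (1 - z)" "inverse ((1 - E p) * (1 - E p))"])
      (auto intro!: derivative_eq_intros simp: E_def)
  then show ?thesis by (simp add: E_def divide_inverse)
qed

section \<open>Estimates for the factors\<close>

lemma norm_inverse_1_minus_le:
  fixes e :: complex and \<kappa> z :: real
  assumes "norm e \<le> z" and \<kappa>: "\<kappa> < 1" and z: "0 \<le> z" "z \<le> \<kappa>"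
  shows "norm (1 - e) \<ge> 1 - \<kappa>" and "inverse (norm (1 - e)) \<le> exp (z / (1 - \<kappa>))"
proof -
  have 1: "norm (1 - e) \<ge> 1 - z"
    using assms norm_triangle_ineq2[of 1 e] by simp
  with z show "norm (1 - e) \<ge> 1 - \<kappa>" by simp
  have "inverse (norm (1 - e)) \<le> inverse (1 - z)"
    using 1 z \<kappa> by (intro le_imp_inverse_le) auto
  also have "\<dots> = 1 + z / (1 - z)" using z \<kappa> by (simp add: field_simps)
  also have "\<dots> \<le> 1 + z / (1 - \<kappa>)" using z \<kappa> by (intro add_left_mono divide_left_mono) auto
  also have "\<dots> \<le> exp (z / (1 - \<kappa>))" by (rule exp_ge_add_one_self)
  finally show "inverse (norm (1 - e)) \<le> exp (z / (1 - \<kappa>))" .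
qed

context
  fixes t e :: complex and \<rho> \<kappa> z :: real
  assumes t: "norm t \<le> \<rho>" and \<rho>: "\<rho> > 0" and \<kappa>: "\<kappa> < 1" and z: "0 \<le> z" "z \<le> \<kappa>"
begin

text \<open>The summand \<open>1 / \<rho>\<close> comes from the case of large exponentials; a
  common exponent allows the bounds for all roots to be multiplied together.\<close>

lemma small_factor_bounds:
  assumes "norm e \<le> z"
  shows "norm ((1 - t * e) / (1 - e)) \<le> exp ((\<rho> + 1 / \<rho> + 1 / (1 - \<kappa>)) * z)"
    and "norm (1 - (1 - t * e) / (1 - e)) \<le> (1 + \<rho>) / (1 - \<kappa>) * z"
    and "e \<noteq> 1"
proof -
  show ne: "e \<noteq> 1" using assms z \<kappa> by auto
  have "norm (1 - t * e) \<le> 1 + norm t * norm e"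
    by (metis norm_mult norm_one norm_triangle_ineq4)
  also have "\<dots> \<le> 1 + \<rho> * z" using t assms \<rho> by (intro add_left_mono mult_mono) auto
  also have "\<dots> \<le> exp (\<rho> * z)" by (rule exp_ge_add_one_self)
  finally have "norm (1 - t * e) \<le> exp (\<rho> * z)" .
  then have "norm ((1 - t * e) / (1 - e)) \<le> exp (\<rho> * z) * exp (z / (1 - \<kappa>))"
    unfolding norm_divide divide_inverse[of "norm _"]
    by (intro mult_mono norm_inverse_1_minus_le assms \<kappa> z) auto
  also have "\<dots> \<le> exp ((\<rho> + 1 / \<rho> + 1 / (1 - \<kappa>)) * z)"
    using z \<rho> by (simp add: algebra_simps flip: exp_add)
  finally show "norm ((1 - t * e) / (1 - e)) \<le> exp ((\<rho> + 1 / \<rho> + 1 / (1 - \<kappa>)) * z)" .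
  have "1 - (1 - t * e) / (1 - e) = (t - 1) * e / (1 - e)"
    using ne by (simp add: field_simps)
  also have "norm \<dots> \<le> (1 + \<rho>) * z / (1 - \<kappa>)"
    unfolding norm_divide norm_mult using assms z \<kappa> t \<rho> norm_inverse_1_minus_le(1)[OF _ \<kappa> z]
    by (intro frac_le mult_mono order.trans[OF norm_triangle_ineq4]) auto
  finally show "norm (1 - (1 - t * e) / (1 - e)) \<le> (1 + \<rho>) / (1 - \<kappa>) * z" by simp
qed

text \<open>In terms of \<open>e' = inverse e\<close> the factor is
  \<open>(e' - t) / (e' - 1)\<close>, so it is close to \<open>t\<close>. Its distance from 1 is
  merely bounded, which suffices because this case occurs for finitely many roots only.\<close>

lemma large_factor_bounds:
  assumes "norm (inverse e) \<le> z" "e \<noteq> 0"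
  shows "norm ((1 - t * e) / (1 - e)) \<le> \<rho> * exp ((\<rho> + 1 / \<rho> + 1 / (1 - \<kappa>)) * z)"
    and "norm (1 - (1 - t * e) / (1 - e)) \<le> (1 + \<rho>) / (1 - \<kappa>)"
    and "e \<noteq> 1"
proof -
  show ne: "e \<noteq> 1" using assms z \<kappa> by auto
  define e' where "e' = inverse e"
  have e': "norm e' \<le> z" "e' \<noteq> 1" using assms ne by (auto simp: e'_def)
  have eq: "(1 - t * e) / (1 - e) = (e' - t) / (e' - 1)"
    using ne assms(2) by (simp add: e'_def field_simps)
  have "norm (e' - t) \<le> z + \<rho>" using t e' by (intro order.trans[OF norm_triangle_ineq4]) auto
  also have "\<dots> = \<rho> * (1 + z / \<rho>)" using \<rho> by (simp add: field_simps)
  also have "\<dots> \<le> \<rho> * exp (z / \<rho>)" using \<rho> by (intro mult_left_mono exp_ge_add_one_self) auto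
  finally have "norm (e' - t) \<le> \<rho> * exp (z / \<rho>)" .
  moreover have "norm (e' - 1) = norm (1 - e')" by (rule norm_minus_commute)
  ultimately have "norm ((1 - t * e) / (1 - e)) \<le> (\<rho> * exp (z / \<rho>)) * exp (z / (1 - \<kappa>))"
    unfolding eq norm_divide divide_inverse[of "norm _"] using e'(1) \<rho>
    by (intro mult_mono) (auto intro: norm_inverse_1_minus_le \<kappa> z)
  also have "\<dots> = \<rho> * exp (z / \<rho> + z / (1 - \<kappa>))" by (simp add: exp_add)
  also have "\<dots> \<le> \<rho> * exp ((\<rho> + 1 / \<rho> + 1 / (1 - \<kappa>)) * z)"
    using z \<rho> by (simp add: algebra_simps)
  finally show "norm ((1 - t * e) / (1 - e)) \<le> \<rho> * exp ((\<rho> + 1 / \<rho> + 1 / (1 - \<kappa>)) * z)" .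
  have "1 - (1 - t * e) / (1 - e) = (1 - t) / (1 - e')"
    unfolding eq using e'(2) by (simp add: field_simps)
  also have "norm \<dots> \<le> (1 + \<rho>) / (1 - \<kappa>)"
    unfolding norm_divide using e' z \<kappa> t \<rho> norm_inverse_1_minus_le(1)[OF _ \<kappa> z]
    by (intro frac_le order.trans[OF norm_triangle_ineq4]) auto
  finally show "norm (1 - (1 - t * e) / (1 - e)) \<le> (1 + \<rho>) / (1 - \<kappa>)" .
qed

end

text \<open>A finite set of exponent vectors lies in a box, over which the sum factors into partial
  sums of geometric series.\<close>

lemma summable_on_PiE_geometric:
  fixes \<kappa> :: real
  assumes "finite I" "0 \<le> \<kappa>" "\<kappa> < 1"
  shows "(\<lambda>n. \<Prod>i\<in>I. \<kappa> ^ n i) summable_on (Pi\<^sub>E I (\<lambda>_. UNIV :: nat set))"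
proof (rule nonneg_bdd_above_summable_on)
  show "bdd_above (sum (\<lambda>n. \<Prod>i\<in>I. \<kappa> ^ n i) ` {F. F \<subseteq> (Pi\<^sub>E I (\<lambda>_. UNIV)) \<and> finite F})"
  proof (rule bdd_aboveI2)
    fix F :: "('a \<Rightarrow> nat) set"
    assume F: "F \<in> {F. F \<subseteq> (Pi\<^sub>E I (\<lambda>_. UNIV)) \<and> finite F}"
    obtain N where N: "\<And>n i. n \<in> F \<Longrightarrow> i \<in> I \<Longrightarrow> n i \<le> N"
    proof
      fix n i assume "n \<in> F" "i \<in> I"
      then show "n i \<le> Max ((\<lambda>(n, i). n i) ` (F \<times> I))"
        using F assms(1) by (intro Max_ge) force+
    qed
    have "(\<Sum>n\<in>F. \<Prod>i\<in>I. \<kappa> ^ n i) \<le> (\<Sum>n\<in>Pi\<^sub>E I (\<lambda>_. {..N}). \<Prod>i\<in>I. \<kappa> ^ n i)"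
      using F N assms by (intro sum_mono2 finite_PiE prod_nonneg) (auto simp: PiE_iff)
    also have "\<dots> = (\<Prod>i\<in>I. \<Sum>k\<le>N. \<kappa> ^ k)"
      using assms by (subst prod_sum_PiE) auto
    also have "\<dots> \<le> (\<Prod>i\<in>I. 1 / (1 - \<kappa>))"
    proof (rule prod_mono, intro conjI)
      show "(\<Sum>k\<le>N. \<kappa> ^ k) \<le> 1 / (1 - \<kappa>)"
        using assms sum_le_suminf[of "\<lambda>k. \<kappa> ^ k" "{..N}"] suminf_geometric[of \<kappa>]
          summable_geometric[of \<kappa>] by simp
    qed (use assms in \<open>auto intro: sum_nonneg\<close>)
    finally show "(\<Sum>n\<in>F. \<Prod>i\<in>I. \<kappa> ^ n i) \<le> (\<Prod>i\<in>I. 1 / (1 - \<kappa>))" .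
  qed
qed (use assms in \<open>auto intro: prod_nonneg\<close>)

section \<open>Kac--Moody root systems\<close>

context kac_moody_root_system
begin

sublocale cartan_pairing \<Delta> "\<lambda>a. a" cv "\<lambda>v l. blinfun_apply l v"
proof (rule cartan_pairing.intro)
  show "finite \<Delta>" by (rule finite_simple_roots)
  show "linear (\<lambda>v. blinfun_apply l v)" for l :: "'a \<Rightarrow>\<^sub>L real"
    by (simp add: linearI blinfun.add_right blinfun.scaleR_right)
  show "linear (\<lambda>l :: 'a \<Rightarrow>\<^sub>L real. blinfun_apply l v)" for v
    by (simp add: linearI blinfun.add_left blinfun.scaleR_left)
  show "f i = 0" if "(\<Sum>i\<in>\<Delta>. f i *\<^sub>R i) = 0" "i \<in> \<Delta>" for f i
    using independentD[OF independent_simple_roots finite_simple_roots _ that] by simp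
  show "f i = 0" if "(\<Sum>i\<in>\<Delta>. f i *\<^sub>R cv i) = 0" "i \<in> \<Delta>" for f i
  proof -
    \<comment> \<open>Independence is assumed for the set of simple coroots, so the coefficients are
      transported from \<open>\<Delta>\<close> to \<open>\<Delta>v\<close>.\<close>
    define g where "g = f \<circ> the_inv_into \<Delta> cv"
    have inj: "inj_on cv \<Delta>" using bij_coroots by (rule bij_betw_imp_inj_on)
    have g: "g (cv i) = f i" if "i \<in> \<Delta>" for i
      using that by (simp add: g_def the_inv_into_f_f[OF inj])
    have "(\<Sum>l\<in>\<Delta>v. g l *\<^sub>R l) = (\<Sum>i\<in>\<Delta>. g (cv i) *\<^sub>R cv i)"
      by (rule sum.reindex_bij_betw[OF bij_coroots, symmetric])
    also have "\<dots> = 0" using that(1) g by (simp cong: sum.cong)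
    finally have "g (cv i) = 0"
      using independentD[OF independent_simple_coroots finite_simple_coroots, of g "cv i"]
        bij_betwE[OF bij_coroots] that(2) by blast
    with g[OF that(2)] show ?thesis by simp
  qed
  show "\<exists>n. blinfun_apply (cv j) i = - real n" if "i \<in> \<Delta>" "j \<in> \<Delta>" "i \<noteq> j" for i j
  proof -
    obtain k where "blinfun_apply (cv j) i = of_int k" "k \<le> 0"
      using pairing_int[OF \<open>i \<in> \<Delta>\<close> \<open>j \<in> \<Delta>\<close> \<open>i \<noteq> j\<close>] by (auto elim!: Ints_cases)
    then show ?thesis by (intro exI[of _ "nat (- k)"]) simp
  qed
qed (use pairing_diag pairing_zero in auto)

section \<open>Weyl group elements as words\<close>

lemma simple_reflection_act: "simple_reflection cv a = act [a]"
  by (simp add: fun_eq_iff simple_reflection_def act_single)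

lemma foldr_simple_reflection: "foldr (\<lambda>a g. simple_reflection cv a \<circ> g) xs id = act xs"
proof (induction xs)
  case (Cons a xs)
  then show ?case using act_append[of "[a]" xs] by (simp add: simple_reflection_act)
qed simp

lemma inv_act: "set xs \<subseteq> \<Delta> \<Longrightarrow> inv (act xs) = act (rev xs)"
  by (rule inv_equality) (simp_all add: act_cancel act_cancel')

lemma weyl_group_words: "weyl_group \<Delta> cv = act ` {xs. set xs \<subseteq> \<Delta>}"
proof (intro equalityI subsetI)
  fix w assume "w \<in> weyl_group \<Delta> cv"
  then show "w \<in> act ` {xs. set xs \<subseteq> \<Delta>}"
  proof induction
    case one
    show ?case by (rule image_eqI[of _ _ "[]"]) simp_all
  next
    case (gen a)
    then show ?case by (intro image_eqI[of _ _ "[a]"]) (simp_all add: simple_reflection_act)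
  next
    case (mult v w)
    then obtain xs ys where "v = act xs" "w = act ys" "set xs \<subseteq> \<Delta>" "set ys \<subseteq> \<Delta>" by blast
    then show ?case by (intro image_eqI[of _ _ "xs @ ys"]) simp_all
  next
    case (inverse w)
    then obtain xs where "w = act xs" "set xs \<subseteq> \<Delta>" by blast
    then show ?case by (intro image_eqI[of _ _ "rev xs"]) (simp_all add: inv_act)
  qed
next
  fix w assume "w \<in> act ` {xs. set xs \<subseteq> \<Delta>}"
  then obtain xs where xs: "w = act xs" "set xs \<subseteq> \<Delta>" by blast
  from xs(2) have "act xs \<in> weyl_group \<Delta> cv"
  proof (induction xs)
    case Nil
    show ?case using weyl_group.one[of \<Delta> cv] unfolding act_Nil .
  next
    case (Cons a xs)
    then have "simple_reflection cv a \<circ> act xs \<in> weyl_group \<Delta> cv"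
      by (intro weyl_group.mult weyl_group.gen) auto
    moreover have "act (a # xs) = simple_reflection cv a \<circ> act xs"
      using act_append[of "[a]" xs] by (simp add: simple_reflection_act)
    ultimately show ?case by metis
  qed
  with xs show "w \<in> weyl_group \<Delta> cv" by simp
qed

lemma weyl_groupE:
  assumes "w \<in> weyl_group \<Delta> cv"
  obtains xs where "set xs \<subseteq> \<Delta>" "w = act xs"
  using assms that unfolding weyl_group_words by blast

lemma dual_action_act:
  assumes "set xs \<subseteq> \<Delta>"
  shows "dual_action (act xs) l = coact xs l"
proof -
  have "(\<lambda>v. blinfun_apply l (inv (act xs) v)) = blinfun_apply (coact xs l)"
    using assms by (simp add: fun_eq_iff inv_act pairing_act_left)
  then show ?thesis by (simp add: dual_action_def blinfun_apply_inverse)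
qed

text \<open>Functionals are determined by their values, so here the action on \<open>V\<close>
  determines the dual action. This identifies \<open>len\<close> with the Weyl group length.\<close>

lemma eqv_iff:
  assumes "set xs \<subseteq> \<Delta>" "set ys \<subseteq> \<Delta>"
  shows "eqv xs ys \<longleftrightarrow> act xs = act ys"
proof -
  have "coact zs = dual_action (act zs)" if "set zs \<subseteq> \<Delta>" for zs
    using dual_action_act[OF that] by (simp add: fun_eq_iff)
  then show ?thesis using assms by (auto simp: eqv_def)
qed

lemma weyl_length_act:
  assumes "set xs \<subseteq> \<Delta>"
  shows "weyl_length \<Delta> cv (act xs) = len xs"
proof -
  have "length ys = n \<and> set ys \<subseteq> \<Delta> \<and> eqv xs ys \<longleftrightarrow> length ys = n \<and> set ys \<subseteq> \<Delta> \<and> act xs = act ys"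
    for ys n
    using eqv_iff[OF assms] by blast
  then show ?thesis by (simp only: weyl_length_def len_def foldr_simple_reflection)
qed

lemma pos_real_roots_eq: "pos_real_roots \<Delta> cv = posroots"
proof -
  have "real_roots \<Delta> cv = {act xs a | xs a. set xs \<subseteq> \<Delta> \<and> a \<in> \<Delta>}"
    unfolding real_roots_def weyl_group_words by blast
  then have "pos_real_roots \<Delta> cv = {v \<in> {act xs a | xs a. set xs \<subseteq> \<Delta> \<and> a \<in> \<Delta>}. pos v}"
    by (simp only: pos_real_roots_def pos_def)
  also have "\<dots> = posroots" unfolding posroots_def by blast
  finally show ?thesis .
qed

lemma coroot_act:
  assumes "set xs \<subseteq> \<Delta>" "a \<in> \<Delta>"
  shows "coroot \<Delta> cv (act xs a) = coact xs (cv a)"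
  unfolding coroot_def
proof (rule the_equality)
  show "\<exists>w\<in>weyl_group \<Delta> cv. \<exists>a0\<in>\<Delta>. act xs a = w a0 \<and> coact xs (cv a) = dual_action w (cv a0)"
    using assms dual_action_act[OF assms(1)] unfolding weyl_group_words by force
next
  fix l assume "\<exists>w\<in>weyl_group \<Delta> cv. \<exists>a0\<in>\<Delta>. act xs a = w a0 \<and> l = dual_action w (cv a0)"
  then obtain ys b where "set ys \<subseteq> \<Delta>" "b \<in> \<Delta>" "act xs a = act ys b" "l = coact ys (cv b)"
    using dual_action_act unfolding weyl_group_words by auto
  then show "l = coact xs (cv a)" using coroot_unique[of ys xs b a] assms by simp
qed

lemma dual_action_coroot:
  assumes "w \<in> weyl_group \<Delta> cv"
  obtains \<nu> :: "'a \<Rightarrow> 'a \<Rightarrow> nat" and N where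
    "inj_on \<nu> (pos_real_roots \<Delta> cv)" "\<nu> ` pos_real_roots \<Delta> cv \<subseteq> Pi\<^sub>E \<Delta> (\<lambda>_. UNIV)"
    "\<And>a. a \<in> pos_real_roots \<Delta> cv \<Longrightarrow> \<exists>i\<in>\<Delta>. \<nu> a i \<noteq> 0"
    "\<And>a. a \<in> pos_real_roots \<Delta> cv \<Longrightarrow> dual_action w (coroot \<Delta> cv a) =
       (if a \<in> N then -1 else 1) *\<^sub>R (\<Sum>i\<in>\<Delta>. real (\<nu> a i) *\<^sub>R cv i)"
    "N \<subseteq> pos_real_roots \<Delta> cv" "finite N" "card N = weyl_length \<Delta> cv w"
proof -
  obtain xs where xs: "set xs \<subseteq> \<Delta>" "w = act xs" using weyl_groupE[OF assms] .
  note inv = card_inversions[OF xs(1)]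
  obtain \<nu> :: "'a \<Rightarrow> 'a \<Rightarrow> nat" where
    "inj_on \<nu> posroots" "\<nu> ` posroots \<subseteq> Pi\<^sub>E \<Delta> (\<lambda>_. UNIV)"
    "\<And>v. v \<in> posroots \<Longrightarrow> \<exists>i\<in>\<Delta>. \<nu> v i \<noteq> 0"
    "\<And>v. v \<in> posroots \<Longrightarrow> coact xs (coroot \<Delta> cv v) =
       (if v \<in> inversions xs then -1 else 1) *\<^sub>R (\<Sum>i\<in>\<Delta>. real (\<nu> v i) *\<^sub>R cv i)"
    using coroot_coordinates[OF xs(1), of "coroot \<Delta> cv"] coroot_act by blast
  then show thesis
    using that[of \<nu> "inversions xs"] inv xs weyl_length_act dual_action_act
    by (simp add: pos_real_roots_eq inversions_def)
qed

lemma weyl_group_bij: "u \<in> weyl_group \<Delta> cv \<Longrightarrow> bij u"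
  by (metis act_cancel act_cancel' bijI' weyl_groupE)

lemma continuous_weyl: "u \<in> weyl_group \<Delta> cv \<Longrightarrow> continuous_on UNIV u"
proof (induction rule: weyl_group.induct)
  case one
  show ?case unfolding id_def by (rule continuous_on_id)
next
  case (gen a)
  show ?case unfolding simple_reflection_def[abs_def] by (intro continuous_intros)
next
  case (mult v w)
  then show ?case using continuous_on_compose continuous_on_subset by blast
next
  case (inverse w)
  then obtain xs where "set xs \<subseteq> \<Delta>" "inv w = act (rev xs)" using weyl_groupE inv_act by metis
  moreover have "continuous_on UNIV (act ys)" for ys
  proof (induction ys)
    case (Cons a ys)
    then show ?case unfolding act_Cons[abs_def] by (intro continuous_intros)
  qed (simp add: id_def)
  ultimately show ?case by simp
qed

text \<open>Invariance of the pairing moves the chamber containing \<open>y\<close> back to the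
  fundamental one and replaces \<open>w\<close> by \<open>inv u \<circ> w\<close>.\<close>

lemma dual_action_transport:
  assumes "u \<in> weyl_group \<Delta> cv" "w \<in> weyl_group \<Delta> cv"
  shows "blinfun_apply (dual_action w l) y = blinfun_apply (dual_action (inv u \<circ> w) l) (inv u y)"
proof -
  obtain xs ys where xs: "set xs \<subseteq> \<Delta>" "w = act xs" and ys: "set ys \<subseteq> \<Delta>" "u = act ys"
    using weyl_groupE[OF assms(1)] weyl_groupE[OF assms(2)] by metis
  have "inv u \<circ> w = act (rev ys @ xs)" using xs ys by (simp add: inv_act)
  then have "dual_action (inv u \<circ> w) l = coact (rev ys) (coact xs l)"
    using xs ys dual_action_act[of "rev ys @ xs"] by simp
  then show ?thesis
    using xs ys pairing_act[where xs = "rev ys" and v = y and l = "coact xs l"] by (simp add: inv_act dual_action_act)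
qed

section \<open>Convergence of the Poincare majorant\<close>

lemma finite_weyl_length:
  "finite {w \<in> weyl_group \<Delta> cv. weyl_length \<Delta> cv w = n}"
proof (rule finite_subset)
  show "{w \<in> weyl_group \<Delta> cv. weyl_length \<Delta> cv w = n} \<subseteq> act ` {xs. set xs \<subseteq> \<Delta> \<and> length xs = n}"
  proof safe
    fix w assume "w \<in> weyl_group \<Delta> cv"
    then obtain xs where xs: "set xs \<subseteq> \<Delta>" "w = act xs" by (rule weyl_groupE)
    then obtain ys where ys: "length ys = len xs" "set ys \<subseteq> \<Delta>" "eqv xs ys" using len_witness by blast
    with xs show "w \<in> act ` {xs. set xs \<subseteq> \<Delta> \<and> length xs = weyl_length \<Delta> cv w}"
      by (intro image_eqI[of _ _ ys]) (simp_all add: weyl_length_act eqv_def len_cong[OF ys(3)])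
  qed
  show "finite (act ` {xs. set xs \<subseteq> \<Delta> \<and> length xs = n})"
    by (intro finite_imageI finite_lists_length_eq finite_simple_roots)
qed

text \<open>Grouping a finite sum by length bounds it by the Poincare series at
  \<open>\<rho>\<close>, which converges absolutely inside its radius of convergence.\<close>

lemma summable_on_weyl_length:
  assumes "0 \<le> \<rho>" "ereal \<rho> < fps_conv_radius (poincare_series \<Delta> cv)"
  shows "(\<lambda>w. \<rho> ^ weyl_length \<Delta> cv w) summable_on weyl_group \<Delta> cv"
proof (rule nonneg_bdd_above_summable_on)
  define W where "W n = {w \<in> weyl_group \<Delta> cv. weyl_length \<Delta> cv w = n}" for n
  have "summable (\<lambda>n. norm (fps_nth (poincare_series \<Delta> cv) n * complex_of_real \<rho> ^ n))"
    using assms by (intro norm_summable_fps) simp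
  then have sum: "summable (\<lambda>n. real (card (W n)) * \<rho> ^ n)"
    using assms(1) by (simp add: poincare_series_def W_def norm_mult norm_power)
  show "bdd_above (sum (\<lambda>w. \<rho> ^ weyl_length \<Delta> cv w) ` {F. F \<subseteq> weyl_group \<Delta> cv \<and> finite F})"
  proof (rule bdd_aboveI2)
    fix F assume F: "F \<in> {F. F \<subseteq> weyl_group \<Delta> cv \<and> finite F}"
    define T where "T = weyl_length \<Delta> cv ` F"
    have T: "finite T" using F by (simp add: T_def)
    have "(\<Sum>w\<in>F. \<rho> ^ weyl_length \<Delta> cv w) =
        (\<Sum>n\<in>T. \<Sum>w\<in>{w \<in> F. weyl_length \<Delta> cv w = n}. \<rho> ^ weyl_length \<Delta> cv w)"
      using F T by (intro sum.group[symmetric]) (auto simp: T_def)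
    also have "\<dots> \<le> (\<Sum>n\<in>T. real (card (W n)) * \<rho> ^ n)"
    proof (rule sum_mono)
      fix n
      have "card {w \<in> F. weyl_length \<Delta> cv w = n} \<le> card (W n)"
        using F finite_weyl_length by (intro card_mono) (auto simp: W_def)
      then show "(\<Sum>w\<in>{w \<in> F. weyl_length \<Delta> cv w = n}. \<rho> ^ weyl_length \<Delta> cv w) \<le> real (card (W n)) * \<rho> ^ n"
        using assms(1) by (simp add: mult_right_mono)
    qed
    also have "\<dots> \<le> (\<Sum>n. real (card (W n)) * \<rho> ^ n)"
      using sum T assms(1) by (intro sum_le_suminf) auto
    finally show "(\<Sum>w\<in>F. \<rho> ^ weyl_length \<Delta> cv w) \<le> (\<Sum>n. real (card (W n)) * \<rho> ^ n)" .
  qed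
qed (use assms in auto)

lemma summable_on_weyl_translate:
  fixes f :: "('a \<Rightarrow> 'a) \<Rightarrow> real"
  assumes "u \<in> weyl_group \<Delta> cv" "f summable_on weyl_group \<Delta> cv"
  shows "(\<lambda>w. f (inv u \<circ> w)) summable_on weyl_group \<Delta> cv"
proof -
  have u: "bij u" using weyl_group_bij[OF assms(1)] .
  have "bij_betw (\<lambda>w. inv u \<circ> w) (weyl_group \<Delta> cv) (weyl_group \<Delta> cv)"
  proof (rule bij_betwI[of _ _ _ "\<lambda>w. u \<circ> w"])
    show "inv u \<circ> (u \<circ> w) = w" "u \<circ> (inv u \<circ> w) = w" for w
      using u by (simp_all add: fun_eq_iff bij_is_inj bij_is_surj surj_f_inv_f)
  qed (auto intro: weyl_group.mult weyl_group.inverse assms(1))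
  from summable_on_reindex_bij_betw[OF this, of f] assms(2) show ?thesis by simp
qed

section \<open>Local majorants for the terms\<close>

definition root_exponential :: "'a \<times> 'a \<Rightarrow> ('a \<Rightarrow> 'a) \<Rightarrow> 'a \<Rightarrow> complex" where
  "root_exponential h w a =
     exp (2 * of_real pi * \<i> * complexified_pairing h (dual_action w (coroot \<Delta> cv a)))"

lemma c_factor_eq:
  "c_factor \<Delta> cv t h w a = (1 - t * root_exponential h w a) / (1 - root_exponential h w a)"
  by (simp add: c_factor_def root_exponential_def Let_def)

lemma norm_root_exponential:
  "norm (root_exponential (x, y) w a) = exp (- (2 * pi * blinfun_apply (dual_action w (coroot \<Delta> cv a)) y))"
  by (simp add: root_exponential_def norm_exp_eq_Re complexified_pairing_def)

text \<open>
  Here \<open>N\<close> is the set of inversions of \<open>u\<inverse>w\<close>, and \<open>z a\<close> is \<open>exp (- 2\<pi>\<delta>)\<close> to the power of the height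
  of \<open>\<plusminus>u\<inverse>wa\<^sup>\<or>\<close>.
\<close>

lemma root_exponential_bounds:
  assumes u: "u \<in> weyl_group \<Delta> cv" and w: "w \<in> weyl_group \<Delta> cv" and "\<delta> > 0"
  obtains z N where
    "\<And>a. a \<in> pos_real_roots \<Delta> cv \<Longrightarrow> 0 \<le> z a \<and> z a \<le> exp (- (2 * pi * \<delta>))"
    "z summable_on pos_real_roots \<Delta> cv"
    "infsum z (pos_real_roots \<Delta> cv) \<le>
       (\<Sum>\<^sub>\<infinity>n\<in>Pi\<^sub>E \<Delta> (\<lambda>_. UNIV). \<Prod>i\<in>\<Delta>. exp (- (2 * pi * \<delta>)) ^ n i)"
    "N \<subseteq> pos_real_roots \<Delta> cv" "finite N" "card N = weyl_length \<Delta> cv (inv u \<circ> w)"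
    "\<And>x y a. \<forall>i\<in>\<Delta>. cv i (inv u y) > \<delta> \<Longrightarrow> a \<in> pos_real_roots \<Delta> cv \<Longrightarrow> a \<notin> N \<Longrightarrow>
       norm (root_exponential (x, y) w a) \<le> z a"
    "\<And>x y a. \<forall>i\<in>\<Delta>. cv i (inv u y) > \<delta> \<Longrightarrow> a \<in> pos_real_roots \<Delta> cv \<Longrightarrow> a \<in> N \<Longrightarrow>
       norm (inverse (root_exponential (x, y) w a)) \<le> z a"
proof -
  define \<kappa> where "\<kappa> = exp (- (2 * pi * \<delta>))"
  have \<kappa>: "0 < \<kappa>" "\<kappa> < 1" using \<open>\<delta> > 0\<close> by (auto simp: \<kappa>_def)
  have uw: "inv u \<circ> w \<in> weyl_group \<Delta> cv" using u w by (intro weyl_group.mult weyl_group.inverse)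
  obtain \<nu> :: "'a \<Rightarrow> 'a \<Rightarrow> nat" and N where \<nu>:
    "inj_on \<nu> (pos_real_roots \<Delta> cv)" "\<nu> ` pos_real_roots \<Delta> cv \<subseteq> Pi\<^sub>E \<Delta> (\<lambda>_. UNIV)"
    "\<And>a. a \<in> pos_real_roots \<Delta> cv \<Longrightarrow> \<exists>i\<in>\<Delta>. \<nu> a i \<noteq> 0"
    "\<And>a. a \<in> pos_real_roots \<Delta> cv \<Longrightarrow> dual_action (inv u \<circ> w) (coroot \<Delta> cv a) =
       (if a \<in> N then -1 else 1) *\<^sub>R (\<Sum>i\<in>\<Delta>. real (\<nu> a i) *\<^sub>R cv i)"
    and N: "N \<subseteq> pos_real_roots \<Delta> cv" "finite N" "card N = weyl_length \<Delta> cv (inv u \<circ> w)"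
    using dual_action_coroot[OF uw] by blast
  define G where "G n = (\<Prod>i\<in>\<Delta>. \<kappa> ^ n i)" for n :: "'a \<Rightarrow> nat"
  have G: "G summable_on Pi\<^sub>E \<Delta> (\<lambda>_. UNIV)"
    unfolding G_def using summable_on_PiE_geometric[OF finite_simple_roots, of \<kappa>] \<kappa> by simp
  have G0: "0 \<le> G n" for n unfolding G_def using \<kappa> by (intro prod_nonneg) auto
  define z where "z a = G (\<nu> a)" for a
  have GV: "G summable_on \<nu> ` pos_real_roots \<Delta> cv"
    using summable_on_subset_banach[OF G \<nu>(2)] .
  have z_le: "z a \<le> \<kappa>" if a: "a \<in> pos_real_roots \<Delta> cv" for a
  proof -
    \<comment> \<open>A nonzero coordinate supplies at least one factor \<open>\<kappa>\<close>; all
      other factors are at most 1.\<close>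
    obtain i where i: "i \<in> \<Delta>" "\<nu> a i \<noteq> 0" using \<nu>(3)[OF a] by blast
    have "z a = \<kappa> ^ \<nu> a i * (\<Prod>j\<in>\<Delta> - {i}. \<kappa> ^ \<nu> a j)"
      unfolding z_def G_def by (rule prod.remove[OF finite_simple_roots i(1)])
    also have "\<dots> \<le> \<kappa> ^ 1 * 1"
      using \<kappa> i(2) by (intro mult_mono power_decreasing prod_le_1 prod_nonneg) (auto simp: power_le_one)
    finally show ?thesis by simp
  qed
  have pairing: "exp (- (2 * pi * (\<Sum>i\<in>\<Delta>. real (\<nu> a i) * cv i y))) \<le> z a"
    if "\<forall>i\<in>\<Delta>. cv i y > \<delta>" for y a
  proof -
    have "exp (- (2 * pi * (\<Sum>i\<in>\<Delta>. real (\<nu> a i) * cv i y))) = (\<Prod>i\<in>\<Delta>. exp (- (2 * pi * cv i y)) ^ \<nu> a i)"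
      using finite_simple_roots
      by (simp add: sum_distrib_left exp_sum mult_ac flip: exp_of_nat_mult sum_negf)
    also have "\<dots> \<le> z a"
      unfolding z_def G_def \<kappa>_def using that
      by (intro prod_mono conjI power_mono) (auto intro: less_imp_le)
    finally show ?thesis .
  qed
  have transport: "blinfun_apply (dual_action w (coroot \<Delta> cv a)) y =
      (if a \<in> N then -1 else 1) * (\<Sum>i\<in>\<Delta>. real (\<nu> a i) * cv i (inv u y))"
    if "a \<in> pos_real_roots \<Delta> cv" for a y
    unfolding dual_action_transport[OF u w] \<nu>(4)[OF that]
    by (simp add: blinfun.scaleR_left blinfun.sum_left blinfun.minus_left)
  show thesis
  proof (rule that[of z N])
    show "z summable_on pos_real_roots \<Delta> cv"
      using GV summable_on_reindex[OF \<nu>(1), of G] by (simp add: z_def[abs_def] o_def)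
    have "infsum z (pos_real_roots \<Delta> cv) = infsum G (\<nu> ` pos_real_roots \<Delta> cv)"
      using infsum_reindex[OF \<nu>(1), of G] by (simp add: z_def[abs_def] o_def)
    also have "\<dots> \<le> infsum G (Pi\<^sub>E \<Delta> (\<lambda>_. UNIV))"
      using G GV \<nu>(2) G0 by (intro infsum_mono2) auto
    finally show "infsum z (pos_real_roots \<Delta> cv) \<le>
        (\<Sum>\<^sub>\<infinity>n\<in>Pi\<^sub>E \<Delta> (\<lambda>_. UNIV). \<Prod>i\<in>\<Delta>. exp (- (2 * pi * \<delta>)) ^ n i)"
      by (simp add: G_def[abs_def] \<kappa>_def)
    show "0 \<le> z a \<and> z a \<le> exp (- (2 * pi * \<delta>))" if "a \<in> pos_real_roots \<Delta> cv" for a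
      using z_le[OF that] G0 by (simp add: z_def \<kappa>_def)
    show "norm (root_exponential (x, y) w a) \<le> z a"
      if "\<forall>i\<in>\<Delta>. cv i (inv u y) > \<delta>" "a \<in> pos_real_roots \<Delta> cv" "a \<notin> N" for x y a
      using pairing[OF that(1), of a] that(3) by (simp add: norm_root_exponential transport[OF that(2)])
    show "norm (inverse (root_exponential (x, y) w a)) \<le> z a"
      if "\<forall>i\<in>\<Delta>. cv i (inv u y) > \<delta>" "a \<in> pos_real_roots \<Delta> cv" "a \<in> N" for x y a
      using pairing[OF that(1), of a] that(3)
      by (simp add: norm_inverse norm_root_exponential transport[OF that(2)] flip: exp_minus)
  qed (use N in auto)
qed


lemma open_shrunken_chamber:
  assumes "u \<in> weyl_group \<Delta> cv"
  shows "open {y. \<forall>i\<in>\<Delta>. cv i (inv u y) > \<delta>}"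
proof -
  have "open {y. cv i (inv u y) > \<delta>}" for i
    using continuous_weyl[OF weyl_group.inverse[OF assms]]
    by (intro open_Collect_less continuous_intros) auto
  then have "open (\<Inter>i\<in>\<Delta>. {y. cv i (inv u y) > \<delta>})"
    using finite_simple_roots by blast
  moreover have "(\<Inter>i\<in>\<Delta>. {y. cv i (inv u y) > \<delta>}) = {y. \<forall>i\<in>\<Delta>. cv i (inv u y) > \<delta>}" by blast
  ultimately show ?thesis by simp
qed

text \<open>The neighbourhood bounds \<open>t\<close> by some \<open>\<rho>\<close> below the radius
  of convergence and keeps \<open>inv u y\<close> a distance \<open>\<delta>\<close> inside all
  walls. Then \<open>w\<close> enters the estimate of its term only through the number of inversions
  of \<open>inv u \<circ> w\<close>.\<close>

lemma local_majorant:
  assumes dom: "p0 \<in> c_domain \<Delta> cv"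
  obtains U M where "open U" "p0 \<in> U" "U \<subseteq> c_domain \<Delta> cv" "M summable_on weyl_group \<Delta> cv"
    "\<And>w a t h. w \<in> weyl_group \<Delta> cv \<Longrightarrow> a \<in> pos_real_roots \<Delta> cv \<Longrightarrow> (t, h) \<in> U \<Longrightarrow>
       root_exponential h w a \<noteq> 1"
    "\<And>w. w \<in> weyl_group \<Delta> cv \<Longrightarrow> \<exists>m. m summable_on pos_real_roots \<Delta> cv \<and>
       (\<forall>a\<in>pos_real_roots \<Delta> cv. 0 \<le> m a \<and>
          (\<forall>(t, h)\<in>U. norm (1 - c_factor \<Delta> cv t h w a) \<le> m a))"
    "\<And>w t h. w \<in> weyl_group \<Delta> cv \<Longrightarrow> (t, h) \<in> U \<Longrightarrow> norm (c_term \<Delta> cv t h w) \<le> M w"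
proof -
  let ?W = "weyl_group \<Delta> cv" and ?\<Phi> = "pos_real_roots \<Delta> cv"
  obtain t0 x0 y0 where p0: "p0 = (t0, x0, y0)" by (metis prod_cases3)
  have t0: "ereal (norm t0) < fps_conv_radius (poincare_series \<Delta> cv)"
    and "y0 \<in> weyl_chambers \<Delta> cv"
    using dom by (auto simp: p0 c_domain_def eball_def)
  then obtain u c where u: "u \<in> ?W" and c: "c \<in> open_chamber \<Delta> cv" "y0 = u c"
    unfolding weyl_chambers_def by blast
  have bij: "bij u" using weyl_group_bij[OF u] .
  then have inv_y0: "inv u y0 = c" using c by (simp add: bij_is_inj)
  obtain \<rho> where "ereal (norm t0) < ereal \<rho>" and \<rho>r: "ereal \<rho> < fps_conv_radius (poincare_series \<Delta> cv)"
    using ereal_dense2[OF t0] by blast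
  then have t0\<rho>: "norm t0 < \<rho>" by simp
  then have \<rho>: "\<rho> > 0" using norm_ge_zero[of t0] by linarith
  \<comment> \<open>Halving the least pairing makes the inequalities strict at \<open>c\<close>. The
    inserted 1 keeps the minimum defined when there are no simple roots.\<close>
  define \<delta> where "\<delta> = Min (insert 1 ((\<lambda>i. cv i c) ` \<Delta>)) / 2"
  have min: "Min (insert 1 ((\<lambda>i. cv i c) ` \<Delta>)) > 0"
    using finite_simple_roots c(1) by (auto simp: open_chamber_def)
  then have \<delta>: "\<delta> > 0" by (simp add: \<delta>_def)
  have c\<delta>: "cv i c > \<delta>" if "i \<in> \<Delta>" for i
  proof -
    have "Min (insert 1 ((\<lambda>i. cv i c) ` \<Delta>)) \<le> cv i c"
      using finite_simple_roots that by (intro Min_le) auto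
    then show ?thesis using min unfolding \<delta>_def by linarith
  qed
  define \<kappa> where "\<kappa> = exp (- (2 * pi * \<delta>))"
  have \<kappa>: "0 < \<kappa>" "\<kappa> < 1" using \<delta> by (auto simp: \<kappa>_def)
  \<comment> \<open>\<open>Z\<close> bounds the sum of the errors \<open>z\<close> over the positive
    roots for every \<open>w\<close> simultaneously.\<close>
  define Z where "Z = (\<Sum>\<^sub>\<infinity>n\<in>Pi\<^sub>E \<Delta> (\<lambda>_. UNIV). \<Prod>i\<in>\<Delta>. \<kappa> ^ n i)"
  define A where "A = \<rho> + 1 / \<rho> + 1 / (1 - \<kappa>)"
  have A: "A \<ge> 0" using \<rho> \<kappa> by (auto simp: A_def intro!: add_nonneg_nonneg)
  define K where "K = (1 + \<rho>) / (1 - \<kappa>)"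
  have K: "K \<ge> 0" using \<rho> \<kappa> by (auto simp: K_def)
  define U where "U = ball (0::complex) \<rho> \<times> (UNIV :: 'a set) \<times> {y. \<forall>i\<in>\<Delta>. cv i (inv u y) > \<delta>}"
  define M where "M w = \<rho> ^ weyl_length \<Delta> cv (inv u \<circ> w) * exp (A * Z)" for w
  have UD: "U \<subseteq> c_domain \<Delta> cv"
  proof
    fix p assume "p \<in> U"
    then obtain t x y where p: "p = (t, x, y)" "norm t < \<rho>" "\<forall>i\<in>\<Delta>. cv i (inv u y) > \<delta>"
      unfolding U_def by auto
    have "y = u (inv u y)" using bij by (simp add: bij_is_surj surj_f_inv_f)
    moreover have "inv u y \<in> open_chamber \<Delta> cv"
      using p(3) \<delta> unfolding open_chamber_def by (auto intro: less_trans)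
    ultimately have "y \<in> weyl_chambers \<Delta> cv" unfolding weyl_chambers_def using u by blast
    moreover have "ereal (norm t) < fps_conv_radius (poincare_series \<Delta> cv)"
      using p(2) \<rho>r by (meson ereal_less_eq(3) less_imp_le order.strict_trans1)
    ultimately show "p \<in> c_domain \<Delta> cv" by (simp add: p c_domain_def eball_def)
  qed
  have main: "(\<forall>a\<in>?\<Phi>. \<forall>(t, h)\<in>U. root_exponential h w a \<noteq> 1) \<and>
      (\<exists>m. m summable_on ?\<Phi> \<and> (\<forall>a\<in>?\<Phi>. 0 \<le> m a \<and> (\<forall>(t, h)\<in>U. norm (1 - c_factor \<Delta> cv t h w a) \<le> m a))) \<and>
      (\<forall>(t, h)\<in>U. norm (c_term \<Delta> cv t h w) \<le> M w)" if w: "w \<in> ?W" for w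
  proof -
    obtain z N where z: "\<And>a. a \<in> ?\<Phi> \<Longrightarrow> 0 \<le> z a \<and> z a \<le> \<kappa>" "z summable_on ?\<Phi>" "infsum z ?\<Phi> \<le> Z"
      and N: "N \<subseteq> ?\<Phi>" "finite N" "card N = weyl_length \<Delta> cv (inv u \<circ> w)"
      and small: "\<And>x y a. \<forall>i\<in>\<Delta>. cv i (inv u y) > \<delta> \<Longrightarrow> a \<in> ?\<Phi> \<Longrightarrow> a \<notin> N \<Longrightarrow>
        norm (root_exponential (x, y) w a) \<le> z a"
      and large: "\<And>x y a. \<forall>i\<in>\<Delta>. cv i (inv u y) > \<delta> \<Longrightarrow> a \<in> ?\<Phi> \<Longrightarrow> a \<in> N \<Longrightarrow>
        norm (inverse (root_exponential (x, y) w a)) \<le> z a"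
      unfolding Z_def \<kappa>_def using root_exponential_bounds[OF u w \<delta>] by blast
    \<comment> \<open>On \<open>N\<close> the factor is near \<open>t\<close> and not near 1, which
      costs a constant; the finiteness of \<open>N\<close> keeps \<open>m\<close> summable.\<close>
    define m where "m a = K * (z a + (if a \<in> N then 1 else 0))" for a
    have factor: "root_exponential h w a \<noteq> 1"
      "norm (1 - c_factor \<Delta> cv t h w a) \<le> m a"
      "norm (c_factor \<Delta> cv t h w a) \<le> (if a \<in> N then \<rho> else 1) * exp (A * z a)"
      if "a \<in> ?\<Phi>" "(t, h) \<in> U" for t h a
    proof -
      obtain x y where h: "h = (x, y)" by fastforce
      have t: "norm t \<le> \<rho>" and y: "\<forall>i\<in>\<Delta>. cv i (inv u y) > \<delta>"
        using that(2) by (auto simp: U_def h)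
      note za = z(1)[OF that(1), THEN conjunct1] z(1)[OF that(1), THEN conjunct2]
      have nz: "root_exponential h w a \<noteq> 0" by (simp add: root_exponential_def)
      have Kz: "K * z a \<ge> 0" using K za by simp
      show "root_exponential h w a \<noteq> 1"
        using small_factor_bounds(3)[OF t \<rho> \<kappa>(2) za small[OF y that(1)]]
          large_factor_bounds(3)[OF t \<rho> \<kappa>(2) za large[OF y that(1)]] nz unfolding h by blast
      show "norm (1 - c_factor \<Delta> cv t h w a) \<le> m a"
        using small_factor_bounds(2)[OF t \<rho> \<kappa>(2) za small[OF y that(1), of x]]
          large_factor_bounds(2)[OF t \<rho> \<kappa>(2) za large[OF y that(1), of x]] nz Kz
        unfolding h c_factor_eq m_def K_def[symmetric] by (auto simp: distrib_left)
      show "norm (c_factor \<Delta> cv t h w a) \<le> (if a \<in> N then \<rho> else 1) * exp (A * z a)"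
        using small_factor_bounds(1)[OF t \<rho> \<kappa>(2) za small[OF y that(1), of x]]
          large_factor_bounds(1)[OF t \<rho> \<kappa>(2) za large[OF y that(1), of x]] nz
        unfolding h c_factor_eq A_def[symmetric] by auto
    qed
    have m: "m summable_on ?\<Phi>"
    proof -
      have "(\<lambda>a. if a \<in> N then 1 else 0 :: real) summable_on ?\<Phi> \<longleftrightarrow> (\<lambda>_. 1 :: real) summable_on N"
        using N(1) by (intro summable_on_cong_neutral) auto
      then show ?thesis
        unfolding m_def using z(2) N(2) by (intro summable_on_cmult_right summable_on_add) auto
    qed
    have m0: "0 \<le> m a" if "a \<in> ?\<Phi>" for a
      using K z(1)[OF that] by (simp add: m_def)
    have "norm (c_term \<Delta> cv t h w) \<le> M w" if th: "(t, h) \<in> U" for t h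
    proof (rule tendsto_upperbound)
      have "uniform_limit U (\<lambda>F (t, h). \<Prod>a\<in>F. c_factor \<Delta> cv t h w a)
          (\<lambda>(t, h). infinite_product (c_factor \<Delta> cv t h w) ?\<Phi>) (finite_subsets_at_top ?\<Phi>)"
        using infinite_product_majorant[of ?\<Phi> U "\<lambda>a (t, h). c_factor \<Delta> cv t h w a" m] factor(2) m m0
        by (simp add: case_prod_unfold)
      from tendsto_uniform_limitI[OF this th]
      show "((\<lambda>F. norm (\<Prod>a\<in>F. c_factor \<Delta> cv t h w a)) \<longlongrightarrow> norm (c_term \<Delta> cv t h w)) (finite_subsets_at_top ?\<Phi>)"
        unfolding c_term_def by (intro tendsto_norm) simp
      \<comment> \<open>The full power of \<open>\<rho>\<close> appears only once \<open>F\<close>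
        contains \<open>N\<close>, which holds eventually along the finite subsets.\<close>
      have bound: "norm (\<Prod>a\<in>F. c_factor \<Delta> cv t h w a) \<le> M w" if F: "finite F" "N \<subseteq> F" "F \<subseteq> ?\<Phi>" for F
      proof -
        have "norm (\<Prod>a\<in>F. c_factor \<Delta> cv t h w a) \<le> (\<Prod>a\<in>F. (if a \<in> N then \<rho> else 1) * exp (A * z a))"
          unfolding prod_norm[symmetric]
          using F by (intro prod_mono conjI norm_ge_zero factor(3)[OF _ th]) auto
        also have "\<dots> = (\<Prod>a\<in>F. if a \<in> N then \<rho> else 1) * exp (A * sum z F)"
          using F(1) by (simp add: prod.distrib exp_sum sum_distrib_left)
        also have "(\<Prod>a\<in>F. if a \<in> N then \<rho> else 1) = \<rho> ^ card N"
          using F by (simp add: prod.If_cases Int_absorb1)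
        also have "sum z F \<le> Z"
          using finite_sum_le_infsum[OF z(2) F(1,3)] z(1,3) by fastforce
        finally show ?thesis
          unfolding M_def N(3)[symmetric] using A \<rho> by (simp add: mult_left_mono)
      qed
      show "\<forall>\<^sub>F F in finite_subsets_at_top ?\<Phi>. norm (\<Prod>a\<in>F. c_factor \<Delta> cv t h w a) \<le> M w"
        unfolding eventually_finite_subsets_at_top using N bound by blast
    qed simp
    moreover have "\<forall>(t, h)\<in>U. norm (1 - c_factor \<Delta> cv t h w a) \<le> m a" if "a \<in> ?\<Phi>" for a
      using factor(2)[OF that] by blast
    moreover have "\<forall>(t, h)\<in>U. root_exponential h w a \<noteq> 1" if "a \<in> ?\<Phi>" for a
      using factor(1)[OF that] by blast
    ultimately show ?thesis using m m0 by (intro conjI exI[of _ m] ballI) auto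
  qed
  show thesis
  proof (rule that[of U M])
    show "open U" unfolding U_def
      by (intro open_Times open_ball open_UNIV open_shrunken_chamber[OF u])
    show "p0 \<in> U" using t0\<rho> c\<delta> by (simp add: p0 U_def inv_y0)
    show "U \<subseteq> c_domain \<Delta> cv" by (rule UD)
    show "M summable_on ?W"
      unfolding M_def using \<rho> \<rho>r
      by (intro summable_on_cmult_left summable_on_weyl_translate[OF u] summable_on_weyl_length) auto
    show "root_exponential h w a \<noteq> 1" if "w \<in> ?W" "a \<in> ?\<Phi>" "(t, h) \<in> U" for w a t h
      using main[OF that(1)] that(2,3) by blast
    show "\<exists>m. m summable_on ?\<Phi> \<and> (\<forall>a\<in>?\<Phi>. 0 \<le> m a \<and>
        (\<forall>(t, h)\<in>U. norm (1 - c_factor \<Delta> cv t h w a) \<le> m a))" if "w \<in> ?W" for w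
      using main[OF that] by (elim conjE)
    show "norm (c_term \<Delta> cv t h w) \<le> M w" if "w \<in> ?W" "(t, h) \<in> U" for w t h
      using main[OF that(1)] that(2) by blast
  qed
qed

section \<open>Convergence and holomorphy of the sum\<close>

lemma complex_diff_c_term:
  assumes "open U" "p \<in> U" and w: "w \<in> weyl_group \<Delta> cv"
    and ne: "\<And>a t h. a \<in> pos_real_roots \<Delta> cv \<Longrightarrow> (t, h) \<in> U \<Longrightarrow> root_exponential h w a \<noteq> 1"
    and m: "m summable_on pos_real_roots \<Delta> cv" "\<And>a. a \<in> pos_real_roots \<Delta> cv \<Longrightarrow> 0 \<le> m a"
      "\<And>a t h. a \<in> pos_real_roots \<Delta> cv \<Longrightarrow> (t, h) \<in> U \<Longrightarrow> norm (1 - c_factor \<Delta> cv t h w a) \<le> m a"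
  shows "complex_diff (\<lambda>p. c_term \<Delta> cv (fst p) (snd p) w) p"
proof (rule complex_diff_uniform_limit[OF \<open>open U\<close> _ _ _ \<open>p \<in> U\<close>])
  show "uniform_limit U (\<lambda>F p. \<Prod>a\<in>F. c_factor \<Delta> cv (fst p) (snd p) w a)
      (\<lambda>p. c_term \<Delta> cv (fst p) (snd p) w) (finite_subsets_at_top (pos_real_roots \<Delta> cv))"
    unfolding c_term_def using m by (intro infinite_product_majorant[where m = m]) auto
  have "complex_diff (\<lambda>p. c_factor \<Delta> cv (fst p) (snd p) w a) q"
    if "a \<in> pos_real_roots \<Delta> cv" "q \<in> U" for a q
    unfolding c_factor_eq root_exponential_def
    using ne[of a "fst q" "snd q"] that
    by (intro complex_diff_exponential_factor) (simp add: root_exponential_def)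
  then show "\<forall>\<^sub>F F in finite_subsets_at_top (pos_real_roots \<Delta> cv). \<forall>q\<in>U.
      complex_diff (\<lambda>p. \<Prod>a\<in>F. c_factor \<Delta> cv (fst p) (snd p) w a) q"
    by (intro eventually_finite_subsets_at_top_weakI ballI complex_diff_prod) auto
qed simp

lemma c_sum_converges:
  shows "\<forall>(t, h) \<in> c_domain \<Delta> cv. \<forall>w \<in> weyl_group \<Delta> cv.
            (\<forall>a \<in> pos_real_roots \<Delta> cv. 1 - root_exponential h w a \<noteq> 0) \<and>
            abs_convergent_product_on (c_factor \<Delta> cv t h w) (pos_real_roots \<Delta> cv)"
    and "\<forall>(t, h) \<in> c_domain \<Delta> cv. (\<lambda>w. norm (c_term \<Delta> cv t h w)) summable_on weyl_group \<Delta> cv"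
proof -
  show "\<forall>(t, h) \<in> c_domain \<Delta> cv. \<forall>w \<in> weyl_group \<Delta> cv.
            (\<forall>a \<in> pos_real_roots \<Delta> cv. 1 - root_exponential h w a \<noteq> 0) \<and>
            abs_convergent_product_on (c_factor \<Delta> cv t h w) (pos_real_roots \<Delta> cv)"
  proof clarify
    fix t x y w assume dom: "(t, x, y) \<in> c_domain \<Delta> cv" and w: "w \<in> weyl_group \<Delta> cv"
    obtain U M where U: "(t, x, y) \<in> U"
      "\<And>w a t h. w \<in> weyl_group \<Delta> cv \<Longrightarrow> a \<in> pos_real_roots \<Delta> cv \<Longrightarrow> (t, h) \<in> U \<Longrightarrow>
         root_exponential h w a \<noteq> 1"
      "\<And>w. w \<in> weyl_group \<Delta> cv \<Longrightarrow> \<exists>m. m summable_on pos_real_roots \<Delta> cv \<and>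
         (\<forall>a\<in>pos_real_roots \<Delta> cv. 0 \<le> m a \<and>
            (\<forall>(t, h)\<in>U. norm (1 - c_factor \<Delta> cv t h w a) \<le> m a))"
      by (rule local_majorant[OF dom]) blast
    obtain m where m: "m summable_on pos_real_roots \<Delta> cv"
      "\<And>a. a \<in> pos_real_roots \<Delta> cv \<Longrightarrow> norm (1 - c_factor \<Delta> cv t (x, y) w a) \<le> m a"
      using U(3)[OF w] U(1) by blast
    have "abs_convergent_product_on (c_factor \<Delta> cv t (x, y) w) (pos_real_roots \<Delta> cv)"
      unfolding abs_convergent_product_on_def using Infinite_Sum.abs_summable_on_comparison_test'[OF m] .
    with U(2)[OF w _ U(1)]
    show "(\<forall>a \<in> pos_real_roots \<Delta> cv. 1 - root_exponential (x, y) w a \<noteq> 0) \<and>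
        abs_convergent_product_on (c_factor \<Delta> cv t (x, y) w) (pos_real_roots \<Delta> cv)"
      by auto
  qed
  show "\<forall>(t, h) \<in> c_domain \<Delta> cv. (\<lambda>w. norm (c_term \<Delta> cv t h w)) summable_on weyl_group \<Delta> cv"
  proof clarify
    fix t x y assume dom: "(t, x, y) \<in> c_domain \<Delta> cv"
    obtain U M where U: "(t, x, y) \<in> U" "M summable_on weyl_group \<Delta> cv"
      "\<And>w t h. w \<in> weyl_group \<Delta> cv \<Longrightarrow> (t, h) \<in> U \<Longrightarrow> norm (c_term \<Delta> cv t h w) \<le> M w"
      by (rule local_majorant[OF dom]) blast
    show "(\<lambda>w. norm (c_term \<Delta> cv t (x, y) w)) summable_on weyl_group \<Delta> cv"
      using U(3)[OF _ U(1)] by (rule Infinite_Sum.abs_summable_on_comparison_test'[OF U(2)])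
  qed
qed

text \<open>Finitely many neighbourhoods from \<open>local_majorant\<close> cover \<open>K\<close>,
  and the absolute values of their majorants are added.\<close>

lemma compact_majorant:
  assumes "compact K" "K \<subseteq> c_domain \<Delta> cv"
  obtains M where "M summable_on weyl_group \<Delta> cv"
    "\<And>w t h. w \<in> weyl_group \<Delta> cv \<Longrightarrow> (t, h) \<in> K \<Longrightarrow> norm (c_term \<Delta> cv t h w) \<le> M w"
proof -
  have "\<exists>U M. open U \<and> p \<in> U \<and> M summable_on weyl_group \<Delta> cv \<and>
      (\<forall>w\<in>weyl_group \<Delta> cv. \<forall>(t, h)\<in>U. norm (c_term \<Delta> cv t h w) \<le> M w)" if "p \<in> K" for p
  proof -
    have dom: "p \<in> c_domain \<Delta> cv" using that assms(2) by blast
    obtain U M where "open U" "p \<in> U" "M summable_on weyl_group \<Delta> cv"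
      "\<And>w t h. w \<in> weyl_group \<Delta> cv \<Longrightarrow> (t, h) \<in> U \<Longrightarrow> norm (c_term \<Delta> cv t h w) \<le> M w"
      by (rule local_majorant[OF dom]) blast
    then show ?thesis by (intro exI[of _ U] exI[of _ M]) auto
  qed
  then have "\<forall>p\<in>K. \<exists>U M. open U \<and> p \<in> U \<and> M summable_on weyl_group \<Delta> cv \<and>
      (\<forall>w\<in>weyl_group \<Delta> cv. \<forall>(t, h)\<in>U. norm (c_term \<Delta> cv t h w) \<le> M w)" ..
  from bchoice[OF this] obtain U where "\<forall>p\<in>K. \<exists>M. open (U p) \<and> p \<in> U p \<and> M summable_on weyl_group \<Delta> cv \<and>
      (\<forall>w\<in>weyl_group \<Delta> cv. \<forall>(t, h)\<in>U p. norm (c_term \<Delta> cv t h w) \<le> M w)" ..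
  from bchoice[OF this] obtain M where UM: "\<forall>p\<in>K. open (U p) \<and> p \<in> U p \<and> M p summable_on weyl_group \<Delta> cv \<and>
      (\<forall>w\<in>weyl_group \<Delta> cv. \<forall>(t, h)\<in>U p. norm (c_term \<Delta> cv t h w) \<le> M p w)" ..
  have U: "open (U p)" "p \<in> U p" and M: "M p summable_on weyl_group \<Delta> cv"
    "\<And>w t h. w \<in> weyl_group \<Delta> cv \<Longrightarrow> (t, h) \<in> U p \<Longrightarrow> norm (c_term \<Delta> cv t h w) \<le> M p w"
    if "p \<in> K" for p
    using UM[rule_format, OF that] by auto
  obtain T where T: "T \<subseteq> K" "finite T" "K \<subseteq> (\<Union>p\<in>T. U p)"
    using compactE_image[OF assms(1), of K U] U by blast
  show thesis
  proof (rule that)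
    have "(\<lambda>w. \<Sum>p\<in>T'. \<bar>M p w\<bar>) summable_on weyl_group \<Delta> cv" if "finite T'" "T' \<subseteq> K" for T'
      using that
    proof (induction T' rule: finite_induct)
      case (insert p T')
      then have "(\<lambda>w. \<bar>M p w\<bar>) summable_on weyl_group \<Delta> cv"
        using M(1)[of p] summable_on_iff_abs_summable_on_real[of "M p"] by simp
      with insert show ?case by (simp add: summable_on_add)
    qed simp
    then show "(\<lambda>w. \<Sum>p\<in>T. \<bar>M p w\<bar>) summable_on weyl_group \<Delta> cv" using T by blast
    fix w t h assume w: "w \<in> weyl_group \<Delta> cv" and "(t, h) \<in> K"
    then obtain p where p: "p \<in> T" "(t, h) \<in> U p" using T(3) by blast
    have "norm (c_term \<Delta> cv t h w) \<le> \<bar>M p w\<bar>" using M(2)[of p w t h] p T(1) w by force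
    also have "\<dots> \<le> (\<Sum>p\<in>T. \<bar>M p w\<bar>)" using p T(2) by (intro member_le_sum) auto
    finally show "norm (c_term \<Delta> cv t h w) \<le> (\<Sum>p\<in>T. \<bar>M p w\<bar>)" .
  qed
qed

text \<open>Near each point the M-test makes the partial sums converge uniformly, and each term is
  itself a locally uniform limit of finite products, so \<open>complex_diff_uniform_limit\<close> is
  applied at both levels.\<close>

lemma holomorphic_c_sum:
  "holomorphic_on_complexified (\<lambda>(t, h). c_sum \<Delta> cv t h) (c_domain \<Delta> cv)"
  unfolding holomorphic_on_complexified_iff
proof (intro conjI ballI)
  show "open (c_domain \<Delta> cv)"
  proof (rule Topological_Spaces.openI)
    fix p assume p: "p \<in> c_domain \<Delta> cv"
    obtain U where "open U" "p \<in> U" "U \<subseteq> c_domain \<Delta> cv"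
      by (rule local_majorant[OF p]) blast
    then show "\<exists>T. open T \<and> p \<in> T \<and> T \<subseteq> c_domain \<Delta> cv" by blast
  qed
  fix p assume p: "p \<in> c_domain \<Delta> cv"
  obtain U M where U: "open U" "p \<in> U" "M summable_on weyl_group \<Delta> cv"
    and ne: "\<And>w a t h. w \<in> weyl_group \<Delta> cv \<Longrightarrow> a \<in> pos_real_roots \<Delta> cv \<Longrightarrow> (t, h) \<in> U \<Longrightarrow>
       root_exponential h w a \<noteq> 1"
    and m: "\<And>w. w \<in> weyl_group \<Delta> cv \<Longrightarrow> \<exists>m. m summable_on pos_real_roots \<Delta> cv \<and>
       (\<forall>a\<in>pos_real_roots \<Delta> cv. 0 \<le> m a \<and>
          (\<forall>(t, h)\<in>U. norm (1 - c_factor \<Delta> cv t h w a) \<le> m a))"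
    and M: "\<And>w t h. w \<in> weyl_group \<Delta> cv \<Longrightarrow> (t, h) \<in> U \<Longrightarrow> norm (c_term \<Delta> cv t h w) \<le> M w"
    by (rule local_majorant[OF p]) blast
  have diff: "complex_diff (\<lambda>p. c_term \<Delta> cv (fst p) (snd p) w) q"
    if w: "w \<in> weyl_group \<Delta> cv" and q: "q \<in> U" for w q
  proof -
    obtain m' where m': "m' summable_on pos_real_roots \<Delta> cv"
      "\<forall>a\<in>pos_real_roots \<Delta> cv. 0 \<le> m' a \<and> (\<forall>(t, h)\<in>U. norm (1 - c_factor \<Delta> cv t h w a) \<le> m' a)"
      using m[OF w] by blast
    show ?thesis
    proof (rule complex_diff_c_term[OF U(1) q w ne[OF w] m'(1)])
    qed (use m'(2) in blast)+
  qed
  have "complex_diff (\<lambda>p. c_sum \<Delta> cv (fst p) (snd p)) p"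
  proof (rule complex_diff_uniform_limit[OF U(1) _ _ _ U(2)])
    show "uniform_limit U (\<lambda>F p. \<Sum>w\<in>F. c_term \<Delta> cv (fst p) (snd p) w)
        (\<lambda>p. c_sum \<Delta> cv (fst p) (snd p)) (finite_subsets_at_top (weyl_group \<Delta> cv))"
      unfolding c_sum_def using M U(3) by (intro Weierstrass_m_test_general[where M = M]) auto
    show "\<forall>\<^sub>F F in finite_subsets_at_top (weyl_group \<Delta> cv). \<forall>q\<in>U.
        complex_diff (\<lambda>p. \<Sum>w\<in>F. c_term \<Delta> cv (fst p) (snd p) w) q"
      using diff by (intro eventually_finite_subsets_at_top_weakI ballI complex_diff_sum) auto
  qed simp
  then show "complex_diff (\<lambda>(t, h). c_sum \<Delta> cv t h) p" by (simp add: case_prod_unfold)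
qed

text \<open>The M-test is applied to the norms of the terms, so the convergence obtained on
  \<open>K\<close> is both absolute and uniform.\<close>

lemma uniform_limit_c_sum:
  assumes "compact K" "K \<subseteq> c_domain \<Delta> cv"
  shows "uniform_limit K (\<lambda>F (t, h). \<Sum>w\<in>F. norm (c_term \<Delta> cv t h w))
     (\<lambda>(t, h). \<Sum>\<^sub>\<infinity>w\<in>weyl_group \<Delta> cv. norm (c_term \<Delta> cv t h w))
     (finite_subsets_at_top (weyl_group \<Delta> cv))"
proof -
  obtain M where "M summable_on weyl_group \<Delta> cv"
    "\<And>w t h. w \<in> weyl_group \<Delta> cv \<Longrightarrow> (t, h) \<in> K \<Longrightarrow> norm (c_term \<Delta> cv t h w) \<le> M w"
    by (rule compact_majorant[OF assms]) blast
  then show ?thesis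
    using Weierstrass_m_test_general[of "weyl_group \<Delta> cv" K "\<lambda>w (t, h). norm (c_term \<Delta> cv t h w)" M]
    by (simp add: case_prod_unfold)
qed

end

theorem corollary3p1p3:
  fixes \<Delta> :: "'a::real_normed_vector set"
    and \<Delta>v :: "('a \<Rightarrow>\<^sub>L real) set"
    and cv :: "'a \<Rightarrow> ('a \<Rightarrow>\<^sub>L real)"
  assumes "kac_moody_root_system \<Delta> \<Delta>v cv"
  shows "(\<forall>(t, h) \<in> c_domain \<Delta> cv. \<forall>w \<in> weyl_group \<Delta> cv.
            (\<forall>a \<in> pos_real_roots \<Delta> cv.
               1 - exp (2 * of_real pi * \<i> *
                 complexified_pairing h (dual_action w (coroot \<Delta> cv a))) \<noteq> 0) \<and>
            abs_convergent_product_on (c_factor \<Delta> cv t h w) (pos_real_roots \<Delta> cv))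
       \<and> (\<forall>(t, h) \<in> c_domain \<Delta> cv.
            (\<lambda>w. norm (c_term \<Delta> cv t h w)) summable_on weyl_group \<Delta> cv)
       \<and> (\<forall>K. compact K \<and> K \<subseteq> c_domain \<Delta> cv \<longrightarrow>
            uniform_limit K
              (\<lambda>F (t, h). \<Sum>w\<in>F. norm (c_term \<Delta> cv t h w))
              (\<lambda>(t, h). \<Sum>\<^sub>\<infinity>w\<in>weyl_group \<Delta> cv. norm (c_term \<Delta> cv t h w))
              (finite_subsets_at_top (weyl_group \<Delta> cv)))
       \<and> holomorphic_on_complexified (\<lambda>(t, h). c_sum \<Delta> cv t h) (c_domain \<Delta> cv)"
proof -
  interpret kac_moody_root_system \<Delta> \<Delta>v cv by fact
  show ?thesis
    using uniform_limit_c_sum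
    by (intro conjI c_sum_converges[unfolded root_exponential_def] holomorphic_c_sum) blast
qed

end
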